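(* Let $\Gamma=(G,\sigma)$ be a signed graph with $G=(V,E)$, $n=|V|$, let $p\ge 1$, and let $\lambda_1\le\lambda_2\le\dots\le\lambda_n$ be the variational eigenvalues of $\Delta_p^\sigma$. Let $f$ be an eigenfunction of $\Delta_p^\sigma$ corresponding to an eigenvalue $\lambda$. If $k\in\{1,\dots,n-1\}$ and $\lambda<\lambda_{k+1}$, then $\mathfrak W(f)\le \mathfrak S(f)\le k$.
   Context: Setting. $G=(V,E)$ is a finite simple undirected graph, $n=|V|$, with edge measure $w:E\to(0,\infty)$, vertex weight $\mu:V\to(0,\infty)$, potential $\kappa:V\to\mathbb R$ and signature $\sigma:E\to\{-1,1\}$; $\Gamma=(G,\sigma)$ is a signed graph. Values are written $w_{xy},\sigma_{xy},\mu_x,\kappa_x$, and $x\sim y$ means $\{x,y\}\in E$. Put $\Phi_p(t)=|t|^{p-2}t$ for $t\neq0$ and $\Phi_p(0)=0$. Eigenpairs. For $p>1$, $\Delta_p^\sigma f(x)=\sum_{y\sim x}w_{xy}\Phi_p(f(x)-\sigma_{xy}f(y))+\kappa_x\Phi_p(f(x))$, and a nonzero $f:V\to\mathbb R$ is an eigenfunction with eigenvalue $\lambda\in\mathbb R$ if $\Delta_p^\sigma f(x)=\lambda\mu_x\Phi_p(f(x))$ for all $x\in V$. For $p=1$, let $\mathrm{Sgn}(t)=\{1\}$ if $t>0$, $[-1,1]$ if $t=0$, $\{-1\}$ if $t<0$; a nonzero $f:V\to\mathbb R$ is an eigenfunction of $\Delta_1^\sigma$ with eigenvalue $\lambda$ if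 there are numbers $z_{xy}\in\mathrm{Sgn}(f(x)-\sigma_{xy}f(y))$ (for all ordered pairs $x\sim y$) with $z_{xy}=-\sigma_{xy}z_{yx}$, and $z_x,z_x'\in\mathrm{Sgn}(f(x))$, such that $\sum_{y\sim x}w_{xy}z_{xy}+\kappa_xz_x=\lambda\mu_xz'_x$ for all $x\in V$. Variational eigenvalues. $\mathcal S_p=\{f\in\mathbb R^V:\sum_x\mu_x|f(x)|^p=1\}$. For a compact set $S=-S$ its index (Krasnoselskii genus) $\gamma(S)$ is $0$ if $S=\emptyset$, otherwise the least positive integer $k$ for which an odd continuous map $S\to\mathbb R^k\setminus\{0\}$ exists ($\infty$ if none). $\mathcal F_k(\mathcal S_p)$ is the family of compact $A=-A\subset\mathcal S_p$ with $\gamma(A)\ge k$. With $\mathcal R_p^\sigma(f)=\frac{\sum_{\{x,y\}\in E}w_{xy}|f(x)-\sigma_{xy}f(y)|^p+\sum_{x\in V}\kappa_x|f(x)|^p}{\sum_{x\in V}\mu_x|f(x)|^p}$, set $\lambda_k=\inf_{S\in\mathcal F_k(\mathcal S_p)}\sup_{f\in S}\mathcal R_p^\sigma(f)$, $k=1,\dots,n$. Nodal domains. A sequence $x_1,\dots,x_m$ of vertices is a strong nodal domain walk of $f$ if $x_i\sim x_{i+1}$ and $f(x_i)\sigma_{x_ix_{i+1}}f(x_{i+1})>0$ for all $i<m$. A walk $x_1,\dots,x_m$ ($m\ge2$, $x_i\sim x_{i+1}$) is a weak nodal domain walk of $f$ if for all $i<j$ with $f(x_i)\ne0$, $f(x_j)\neq0$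 and $f(x_\ell)=0$ for $i<\ell<j$ one has $f(x_i)\sigma_{x_ix_{i+1}}\cdots\sigma_{x_{j-1}x_j}f(x_j)>0$. On $\Omega=\{x:f(x)\ne0\}$ let $x,y$ be strongly (resp. weakly) equivalent if $x=y$ or a strong (resp. weak) nodal domain walk connects them. $\mathfrak S(f)$ (resp. $\mathfrak W(f)$), the number of strong (resp. weak) nodal domains, is the number of equivalence classes. *)

theory Defs
  imports "HOL-Analysis.Analysis" "HOL-Library.Extended_Nat"
begin

text \<open>
  The vertex set is the finite type \<open>'v\<close>, so that \<open>real ^ 'v\<close> is the space of real functions on
  the vertices. Edges are two-element sets of vertices; \<open>w\<close> and \<open>\<sigma>\<close> are functions on edges,
  and only their values on \<open>E\<close> matter.
\<close>

definition weighted_signed_graph ::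
  "'v::finite set set \<Rightarrow> ('v set \<Rightarrow> real) \<Rightarrow> ('v \<Rightarrow> real) \<Rightarrow> ('v set \<Rightarrow> real) \<Rightarrow> bool" where
  "weighted_signed_graph E w \<mu> \<sigma> \<longleftrightarrow>
     (\<forall>e\<in>E. card e = 2) \<and> (\<forall>e\<in>E. 0 < w e) \<and> (\<forall>x. 0 < \<mu> x) \<and> (\<forall>e\<in>E. \<sigma> e \<in> {-1, 1})"


subsection \<open>Eigenpairs\<close>

definition Phi :: "real \<Rightarrow> real \<Rightarrow> real" where
  "Phi p t = (if t = 0 then 0 else \<bar>t\<bar> powr (p - 2) * t)"

definition p_Laplacian ::
  "'v::finite set set \<Rightarrow> ('v set \<Rightarrow> real) \<Rightarrow> ('v \<Rightarrow> real) \<Rightarrow> ('v set \<Rightarrow> real)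
    \<Rightarrow> real \<Rightarrow> real ^ 'v \<Rightarrow> 'v \<Rightarrow> real" where
  "p_Laplacian E w \<kappa> \<sigma> p f x =
     (\<Sum>y | {x, y} \<in> E. w {x, y} * Phi p (f $ x - \<sigma> {x, y} * f $ y)) + \<kappa> x * Phi p (f $ x)"

definition Sgn :: "real \<Rightarrow> real set" where
  "Sgn t = (if t > 0 then {1} else if t = 0 then {-1..1} else {-1})"

definition is_eigenpair ::
  "'v::finite set set \<Rightarrow> ('v set \<Rightarrow> real) \<Rightarrow> ('v \<Rightarrow> real) \<Rightarrow> ('v \<Rightarrow> real) \<Rightarrow> ('v set \<Rightarrow> real)
    \<Rightarrow> real \<Rightarrow> real ^ 'v \<Rightarrow> real \<Rightarrow> bool" where
  "is_eigenpair E w \<mu> \<kappa> \<sigma> p f lam \<longleftrightarrow> f \<noteq> 0 \<and>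
     (if p = 1 then
        (\<exists>(z :: 'v \<Rightarrow> 'v \<Rightarrow> real) (u :: 'v \<Rightarrow> real) (u' :: 'v \<Rightarrow> real).
           (\<forall>x y. {x, y} \<in> E \<longrightarrow>
              z x y \<in> Sgn (f $ x - \<sigma> {x, y} * f $ y) \<and> z x y = - \<sigma> {x, y} * z y x) \<and>
           (\<forall>x. u x \<in> Sgn (f $ x) \<and> u' x \<in> Sgn (f $ x)) \<and>
           (\<forall>x. (\<Sum>y | {x, y} \<in> E. w {x, y} * z x y) + \<kappa> x * u x = lam * \<mu> x * u' x))
      else (\<forall>x. p_Laplacian E w \<kappa> \<sigma> p f x = lam * \<mu> x * Phi p (f $ x)))"


subsection \<open>Variational eigenvalues\<close>

definition p_sphere :: "('v::finite \<Rightarrow> real) \<Rightarrow> real \<Rightarrow> (real ^ 'v) set" where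
  "p_sphere \<mu> p = {f. (\<Sum>x\<in>UNIV. \<mu> x * \<bar>f $ x\<bar> powr p) = 1}"

text \<open>
  Since the dimension of the target space varies, it is taken from the family
  \<^const>\<open>Euclidean_space\<close> of topologies, whose points are the sequences vanishing from index
  \<open>k\<close> on. The infimum over the empty set is \<open>\<infinity>\<close>.
\<close>

definition genus :: "(real ^ 'v::finite) set \<Rightarrow> enat" where
  "genus S = (if S = {} then 0 else
     Inf {enat k | k. 1 \<le> k \<and>
       (\<exists>g. continuous_map (top_of_set S) (Euclidean_space k) g \<and>
            (\<forall>x\<in>S. g (- x) = - g x) \<and> (\<forall>x\<in>S. g x \<noteq> (\<lambda>i. 0)))})"

definition genus_family :: "('v::finite \<Rightarrow> real) \<Rightarrow> real \<Rightarrow> nat \<Rightarrow> (real ^ 'v) set set" where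
  "genus_family \<mu> p k =
     {A. compact A \<and> uminus ` A = A \<and> A \<subseteq> p_sphere \<mu> p \<and> enat k \<le> genus A}"

text \<open>
  The sum over unordered edges is half the sum over ordered pairs of adjacent vertices: there are
  no loops, and the summand is symmetric in \<open>x\<close> and \<open>y\<close> because \<open>\<sigma>\<close> takes values in \<open>{-1, 1}\<close>.
\<close>

definition Rayleigh ::
  "'v::finite set set \<Rightarrow> ('v set \<Rightarrow> real) \<Rightarrow> ('v \<Rightarrow> real) \<Rightarrow> ('v \<Rightarrow> real) \<Rightarrow> ('v set \<Rightarrow> real)
    \<Rightarrow> real \<Rightarrow> real ^ 'v \<Rightarrow> real" where
  "Rayleigh E w \<mu> \<kappa> \<sigma> p f =
     ((\<Sum>x\<in>UNIV. \<Sum>y | {x, y} \<in> E. w {x, y} * \<bar>f $ x - \<sigma> {x, y} * f $ y\<bar> powr p) / 2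
        + (\<Sum>x\<in>UNIV. \<kappa> x * \<bar>f $ x\<bar> powr p))
     / (\<Sum>x\<in>UNIV. \<mu> x * \<bar>f $ x\<bar> powr p)"

text \<open>
  The real infimum and supremum are proper for \<open>1 \<le> k \<le> CARD('v)\<close>: the quotient is bounded on
  the sphere, the members of the family are then nonempty, and the family contains the sphere.
\<close>

definition variational_eigenvalue ::
  "'v::finite set set \<Rightarrow> ('v set \<Rightarrow> real) \<Rightarrow> ('v \<Rightarrow> real) \<Rightarrow> ('v \<Rightarrow> real) \<Rightarrow> ('v set \<Rightarrow> real)
    \<Rightarrow> real \<Rightarrow> nat \<Rightarrow> real" where
  "variational_eigenvalue E w \<mu> \<kappa> \<sigma> p k =
     (INF S\<in>genus_family \<mu> p k. SUP f\<in>S. Rayleigh E w \<mu> \<kappa> \<sigma> p f)"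


subsection \<open>Nodal domains\<close>

definition strong_walk ::
  "'v::finite set set \<Rightarrow> ('v set \<Rightarrow> real) \<Rightarrow> real ^ 'v \<Rightarrow> 'v list \<Rightarrow> bool" where
  "strong_walk E \<sigma> f xs \<longleftrightarrow> xs \<noteq> [] \<and>
     (\<forall>i. Suc i < length xs \<longrightarrow>
        {xs ! i, xs ! Suc i} \<in> E \<and>
        f $ (xs ! i) * \<sigma> {xs ! i, xs ! Suc i} * f $ (xs ! Suc i) > 0)"

definition weak_walk ::
  "'v::finite set set \<Rightarrow> ('v set \<Rightarrow> real) \<Rightarrow> real ^ 'v \<Rightarrow> 'v list \<Rightarrow> bool" where
  "weak_walk E \<sigma> f xs \<longleftrightarrow> 2 \<le> length xs \<and>
     (\<forall>i. Suc i < length xs \<longrightarrow> {xs ! i, xs ! Suc i} \<in> E) \<and>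
     (\<forall>i j. i < j \<and> j < length xs \<and> f $ (xs ! i) \<noteq> 0 \<and> f $ (xs ! j) \<noteq> 0 \<and>
        (\<forall>l. i < l \<and> l < j \<longrightarrow> f $ (xs ! l) = 0) \<longrightarrow>
        f $ (xs ! i) * (\<Prod>l = i..<j. \<sigma> {xs ! l, xs ! Suc l}) * f $ (xs ! j) > 0)"

definition nonzero_set :: "real ^ 'v::finite \<Rightarrow> 'v set" where
  "nonzero_set f = {x. f $ x \<noteq> 0}"

definition strong_equiv ::
  "'v::finite set set \<Rightarrow> ('v set \<Rightarrow> real) \<Rightarrow> real ^ 'v \<Rightarrow> ('v \<times> 'v) set" where
  "strong_equiv E \<sigma> f = {(x, y). x \<in> nonzero_set f \<and> y \<in> nonzero_set f \<and>
     (x = y \<or> (\<exists>xs. strong_walk E \<sigma> f xs \<and> hd xs = x \<and> last xs = y))}"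

definition weak_equiv ::
  "'v::finite set set \<Rightarrow> ('v set \<Rightarrow> real) \<Rightarrow> real ^ 'v \<Rightarrow> ('v \<times> 'v) set" where
  "weak_equiv E \<sigma> f = {(x, y). x \<in> nonzero_set f \<and> y \<in> nonzero_set f \<and>
     (x = y \<or> (\<exists>xs. weak_walk E \<sigma> f xs \<and> hd xs = x \<and> last xs = y))}"

definition num_strong_nodal_domains ::
  "'v::finite set set \<Rightarrow> ('v set \<Rightarrow> real) \<Rightarrow> real ^ 'v \<Rightarrow> nat" where
  "num_strong_nodal_domains E \<sigma> f = card (nonzero_set f // strong_equiv E \<sigma> f)"

definition num_weak_nodal_domains ::
  "'v::finite set set \<Rightarrow> ('v set \<Rightarrow> real) \<Rightarrow> real ^ 'v \<Rightarrow> nat" where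
  "num_weak_nodal_domains E \<sigma> f = card (nonzero_set f // weak_equiv E \<sigma> f)"

end

theory Submission
  imports Defs "HOL-Library.Poly_Mapping"
begin

text \<open>
  Suppose that \<open>f\<close> has more than \<open>k\<close> strong nodal domains, and consider the linear span of the
  restrictions of \<open>f\<close> to \<open>k + 1\<close> of them. Every function in this span has the form \<open>\<alpha> f\<close>, where \<open>\<alpha>\<close> is
  constant on each strong nodal domain. Testing the eigenvalue equation with \<open>\<bar>\<alpha>\<bar>\<^sup>p f\<close> and applying
  convexity of \<open>\<bar>x\<bar>\<^sup>p\<close> on each edge between different domains shows that the Rayleigh quotient is at
  most \<open>\<lambda>\<close> on the whole span (\<open>Rayleigh_le_eigenvalue\<close>). The intersection of the span with the unit
  sphere has genus at least \<open>k + 1\<close> (\<open>genus_p_sphere_span\<close>), hence it competes in the definition of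
  \<open>\<lambda>\<^bsub>k+1\<^esub>\<close>, and \<open>\<lambda>\<^bsub>k+1\<^esub> \<le> \<lambda>\<close>. Weak nodal domains are unions of strong ones, so there are not more
  of them.

  The bound for the genus is the Borsuk--Ulam theorem (\<open>borsuk_ulam\<close>): an odd continuous map
  from the boundary of a cross-polytope with \<open>2 (n + 1)\<close> vertices to \<open>\<real>\<^sup>n\<close> has a zero. The proof given
  here is combinatorial. Build the cross-polytope from hemispheres of increasing dimension as iterated
  cones, subdivide it finely, and for the coordinates \<open>g\<^sub>0, \<dots>, g\<^sub>n\<^sub>-\<^sub>1\<close> of the map consider the cochain
  that is nonzero on an \<open>n\<close>-simplex \<open>(v\<^sub>0, \<dots>, v\<^sub>n)\<close> if each \<open>g\<^sub>i\<close> changes sign from \<open>v\<^sub>i\<close> to \<open>v\<^sub>i\<^sub>+\<^sub>1\<close>. Its sum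
  over the \<open>n\<close>-dimensional hemisphere is odd: by Stokes' theorem and oddness of the map, the parity
  does not change when the dimension drops by one, and it is odd for a point (\<open>odd_crossing\<close>). So
  some arbitrarily small simplex has a sign change of every coordinate, and in the limit there is a
  common zero.
\<close>

section \<open>Chains of ordered simplices\<close>

text \<open>
  A list of points stands for the ordered simplex that it spans, possibly degenerate, and a chain is
  a formal integer combination of lists. The empty list is the simplex of dimension \<open>-1\<close>, so this
  is an augmented complex.
\<close>

type_synonym 'a chain = "'a list \<Rightarrow>\<^sub>0 int"

text \<open>
  The alternating sum of the codimension-one faces. In this recursive form the signs need no
  bookkeeping: they come from the identity \<open>\<partial> (v * c) = c - v * \<partial> c\<close> for the cone \<open>v * c\<close>, which thereby
  holds on every chain, also in dimension \<open>0\<close> because of the augmentation.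
\<close>

primrec faces :: "'a list \<Rightarrow> 'a chain" where
  "faces [] = 0"
| "faces (v # vs) = frag_of vs - frag_extend (\<lambda>us. frag_of (v # us)) (faces vs)"

definition boundary :: "'a chain \<Rightarrow> 'a chain" where
  "boundary = frag_extend faces"

definition cone_chain :: "'a \<Rightarrow> 'a chain \<Rightarrow> 'a chain" where
  "cone_chain v = frag_extend (\<lambda>vs. frag_of (v # vs))"

definition push :: "('a \<Rightarrow> 'b) \<Rightarrow> 'a chain \<Rightarrow> 'b chain" where
  "push h = frag_extend (\<lambda>vs. frag_of (map h vs))"

text \<open>
  This version keeps the information that only simplices of the given chain matter, which an
  induction on the dimension of the simplices needs.
\<close>

lemma frag_linear_eqI:
  assumes "\<And>x. x \<in> Poly_Mapping.keys c \<Longrightarrow> F (frag_of x) = G (frag_of x)"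
    and "F 0 = (0 :: 'b::ab_group_add)" "G 0 = 0"
    and "\<And>a b. F (a - b) = F a - F b" "\<And>a b. G (a - b) = G a - G b"
  shows "F c = G c"
  using subset_refl
proof (induction c rule: frag_induction)
qed (use assms in auto)

lemma chain_induct [case_names zero simplex diff]:
  assumes "P 0" "\<And>vs. P (frag_of vs)" "\<And>a b. P a \<Longrightarrow> P b \<Longrightarrow> P (a - b)"
  shows "P (c :: 'a chain)"
  using subset_UNIV by (induction c rule: frag_induction) (use assms in auto)

lemmas chain_linear = boundary_def cone_chain_def push_def frag_extend_diff frag_extend_minus
  frag_extend_add frag_extend_cmul

lemma boundary_0 [simp]: "boundary 0 = 0"
  and boundary_of [simp]: "boundary (frag_of vs) = faces vs"
  and boundary_diff: "boundary (c - d) = boundary c - boundary d"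
  and boundary_cmul: "boundary (frag_cmul k c) = frag_cmul k (boundary c)"
  by (simp_all add: chain_linear)

lemma cone_0 [simp]: "cone_chain v 0 = 0"
  and cone_of [simp]: "cone_chain v (frag_of vs) = frag_of (v # vs)"
  and cone_diff: "cone_chain v (c - d) = cone_chain v c - cone_chain v d"
  by (simp_all add: chain_linear)

lemma push_0 [simp]: "push h 0 = 0"
  and push_of [simp]: "push h (frag_of vs) = frag_of (map h vs)"
  and push_diff: "push h (c - d) = push h c - push h d"
  and push_cmul: "push h (frag_cmul k c) = frag_cmul k (push h c)"
  by (simp_all add: chain_linear)

lemma faces_Cons: "faces (v # vs) = frag_of vs - cone_chain v (faces vs)"
  by (simp add: cone_chain_def)

declare faces.simps(2) [simp del]

lemma boundary_cone: "boundary (cone_chain v c) = c - cone_chain v (boundary c)"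
  by (induction c rule: chain_induct) (simp_all add: faces_Cons boundary_diff cone_diff)

lemma boundary_faces: "boundary (faces vs) = 0"
  by (induction vs) (simp_all add: faces_Cons boundary_diff boundary_cone)

lemma push_cone: "push h (cone_chain v c) = cone_chain (h v) (push h c)"
  by (induction c rule: chain_induct) (simp_all add: push_diff cone_diff)

lemma faces_map: "faces (map h vs) = push h (faces vs)"
  by (induction vs) (simp_all add: faces_Cons push_diff push_cone)

lemma boundary_push: "boundary (push h c) = push h (boundary c)"
  by (induction c rule: chain_induct) (simp_all add: boundary_diff push_diff faces_map)

lemma push_push: "push g (push h c) = push (\<lambda>x. g (h x)) c"
  by (induction c rule: chain_induct) (simp_all add: push_diff comp_def)

lemma push_id [simp]: "push (\<lambda>x. x) c = c"
  by (induction c rule: chain_induct) (simp_all add: push_diff)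

lemma keys_cone: "Poly_Mapping.keys (cone_chain v c) \<subseteq> (#) v ` Poly_Mapping.keys c"
  unfolding cone_chain_def using keys_frag_extend[of "\<lambda>vs. frag_of (v # vs)" c] by (auto simp: keys_frag_of)

lemma keys_push: "Poly_Mapping.keys (push h c) \<subseteq> map h ` Poly_Mapping.keys c"
  unfolding push_def using keys_frag_extend[of "\<lambda>vs. frag_of (map h vs)" c] by (auto simp: keys_frag_of)

lemma keys_faces:
  assumes "us \<in> Poly_Mapping.keys (faces vs)"
  shows "Suc (length us) = length vs \<and> set us \<subseteq> set vs"
  using assms
proof (induction vs arbitrary: us)
  case (Cons v vs)
  have "us \<in> Poly_Mapping.keys (frag_of vs) \<union> Poly_Mapping.keys (cone_chain v (faces vs))"
    using subsetD[OF keys_diff Cons.prems[unfolded faces_Cons]] .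
  then have "us = vs \<or> (\<exists>ts\<in>Poly_Mapping.keys (faces vs). us = v # ts)"
    using keys_cone[of v "faces vs"] by (auto simp: keys_frag_of)
  then show ?case using Cons.IH by (elim disjE bexE) fastforce+
qed simp

section \<open>Barycentric subdivision\<close>

definition barycentre :: "'a::real_vector list \<Rightarrow> 'a" where
  "barycentre vs = (1 / real (length vs)) *\<^sub>R sum_list vs"

text \<open>
  The subdivision of a simplex is the cone from its barycentre over the subdivision of its boundary.
  The first argument is the number of vertices; it makes the recursion structural.
\<close>

primrec subdivide :: "nat \<Rightarrow> 'a::real_vector list \<Rightarrow> 'a chain" where
  "subdivide 0 vs = frag_of vs"
| "subdivide (Suc n) vs = cone_chain (barycentre vs) (frag_extend (subdivide n) (faces vs))"

definition subdivision :: "'a::real_vector chain \<Rightarrow> 'a chain" where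
  "subdivision = frag_extend (\<lambda>vs. subdivide (length vs) vs)"

lemma subdivision_0 [simp]: "subdivision 0 = 0"
  and subdivision_of [simp]: "subdivision (frag_of vs) = subdivide (length vs) vs"
  and subdivision_diff: "subdivision (c - d) = subdivision c - subdivision d"
  and subdivision_cmul: "subdivision (frag_cmul k c) = frag_cmul k (subdivision c)"
  by (simp_all add: subdivision_def frag_extend_diff frag_extend_cmul)

lemma subdivide_eq:
  assumes "vs \<noteq> []"
  shows "subdivide (length vs) vs = cone_chain (barycentre vs) (subdivision (faces vs))"
proof -
  obtain n where n: "length vs = Suc n" using assms by (cases vs) auto
  have "frag_extend (subdivide n) (faces vs) = subdivision (faces vs)"
    unfolding subdivision_def by (rule frag_extend_eq) (use n keys_faces in fastforce)
  then show ?thesis by (simp add: n)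
qed

text \<open>
  Subdivision is a chain map: the boundary of the cone over the subdivided boundary \<open>c\<close> is \<open>c\<close> minus
  the cone over \<open>\<partial> c\<close>, and \<open>\<partial> c\<close> vanishes because, by induction, it is the subdivision of the
  boundary of a boundary.
\<close>

lemma boundary_subdivide: "boundary (subdivide (length vs) vs) = subdivision (faces vs)"
proof (induction "length vs" arbitrary: vs rule: less_induct)
  case less
  show ?case
  proof (cases "vs = []")
    case False
    have "boundary (subdivision (faces vs)) = subdivision (boundary (faces vs))"
    proof (rule frag_linear_eqI[where F="\<lambda>c. boundary (subdivision c)" and G="\<lambda>c. subdivision (boundary c)"])
      fix us assume "us \<in> Poly_Mapping.keys (faces vs)"
      then have "length us < length vs" using keys_faces by force
      then show "boundary (subdivision (frag_of us)) = subdivision (boundary (frag_of us))"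
        using less by simp
    qed (simp_all add: boundary_diff subdivision_diff)
    then show ?thesis
      by (simp add: subdivide_eq[OF False] boundary_cone boundary_faces)
  qed simp
qed

lemma boundary_subdivision: "boundary (subdivision c) = subdivision (boundary c)"
  by (induction c rule: chain_induct) (simp_all add: boundary_diff subdivision_diff boundary_subdivide)

lemma sum_list_map_uminus: "sum_list (map uminus vs) = - sum_list (vs :: 'a::ab_group_add list)"
  by (induction vs) auto

lemma barycentre_uminus: "barycentre (map uminus vs) = - barycentre vs"
  by (simp add: barycentre_def sum_list_map_uminus)

text \<open>
  Subdivision commutes with every affine map; the antipodal map is the one of interest.
\<close>

lemma subdivide_uminus: "subdivide n (map uminus vs) = push uminus (subdivide n vs)"
proof (induction n arbitrary: vs)
  case (Suc n)
  have "frag_extend (subdivide n) (push uminus c) = push uminus (frag_extend (subdivide n) c)"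
    for c :: "'a chain"
    by (induction c rule: chain_induct) (simp_all add: push_diff frag_extend_diff Suc)
  then show ?case by (simp add: push_cone barycentre_uminus faces_map)
qed simp

lemma subdivision_uminus: "subdivision (push uminus c) = push uminus (subdivision c)"
  by (induction c rule: chain_induct) (simp_all add: push_diff subdivision_diff subdivide_uminus)

lemma barycentre_in_convex_hull:
  assumes "vs \<noteq> []" shows "barycentre vs \<in> convex hull set vs"
proof -
  have "(\<Sum>i<length vs. (1 / real (length vs)) *\<^sub>R vs ! i) \<in> convex hull set vs"
    by (rule convex_sum) (use assms in \<open>auto intro: hull_inc\<close>)
  then show ?thesis
    by (simp add: barycentre_def sum_list_sum_nth scaleR_sum_right atLeast0LessThan)
qed

text \<open>
  Among the \<open>n\<close> differences whose mean is \<open>barycentre vs - v\<close>, the one for \<open>v\<close> itself is zero; this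
  gives the factor \<open>(n - 1) / n\<close> by which subdivision shrinks simplices.
\<close>

lemma dist_barycentre:
  fixes vs :: "'a::real_normed_vector list"
  assumes D: "\<And>u v. u \<in> set vs \<Longrightarrow> v \<in> set vs \<Longrightarrow> dist u v \<le> D"
    and len: "length vs \<le> Suc N" and v: "v \<in> set vs"
  shows "dist (barycentre vs) v \<le> real N / real (Suc N) * D"
proof -
  let ?n = "length vs"
  obtain j where j: "j < ?n" "vs ! j = v" using v by (auto simp: in_set_conv_nth)
  have n0: "?n > 0" using j by auto
  have D0: "D \<ge> 0" using D[OF v v] by simp
  have "barycentre vs - v = (1 / real ?n) *\<^sub>R (sum_list vs - real ?n *\<^sub>R v)"
    using n0 by (simp add: barycentre_def scaleR_diff_right)
  also have "sum_list vs - real ?n *\<^sub>R v = (\<Sum>i<?n. vs ! i - v)"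
    by (simp add: sum_subtractf sum_list_sum_nth atLeast0LessThan sum_constant_scaleR)
  also have "\<dots> = (\<Sum>i\<in>{..<?n} - {j}. vs ! i - v)"
    using j by (simp add: sum.remove)
  finally have "dist (barycentre vs) v = (1 / real ?n) * norm (\<Sum>i\<in>{..<?n} - {j}. vs ! i - v)"
    by (simp add: dist_norm)
  also have "norm (\<Sum>i\<in>{..<?n} - {j}. vs ! i - v) \<le> (\<Sum>i\<in>{..<?n} - {j}. D)"
    by (rule sum_norm_le) (use D v in \<open>auto simp: dist_norm\<close>)
  also have "\<dots> = (real ?n - 1) * D" using j n0 by (simp add: of_nat_diff)
  finally have "dist (barycentre vs) v \<le> (1 / real ?n) * ((real ?n - 1) * D)"
    using n0 by (simp add: divide_right_mono)
  also have "\<dots> = ((real ?n - 1) / real ?n) * D" by simp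
  also have "\<dots> \<le> real N / real (Suc N) * D"
  proof (rule mult_right_mono[OF _ D0])
    have "1 / real (Suc N) \<le> 1 / real ?n" using n0 len by (intro divide_left_mono) auto
    moreover have "(real ?n - 1) / real ?n = 1 - 1 / real ?n"
      using n0 by (simp add: diff_divide_distrib)
    moreover have "real N / real (Suc N) = 1 - 1 / real (Suc N)"
      by (simp add: divide_simps)
    ultimately show "(real ?n - 1) / real ?n \<le> real N / real (Suc N)" by linarith
  qed
  finally show ?thesis .
qed

lemma keys_subdivideE:
  assumes "ws \<in> Poly_Mapping.keys (subdivide (length vs) vs)" "vs \<noteq> []"
  obtains ts us where "ws = barycentre vs # ts" "us \<in> Poly_Mapping.keys (faces vs)"
    "ts \<in> Poly_Mapping.keys (subdivide (length us) us)"
proof -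
  have "ws \<in> (#) (barycentre vs) ` Poly_Mapping.keys (subdivision (faces vs))"
    using assms(1) unfolding subdivide_eq[OF assms(2)] by (rule subsetD[OF keys_cone])
  then obtain ts where "ws = barycentre vs # ts" "ts \<in> Poly_Mapping.keys (subdivision (faces vs))"
    by (rule imageE)
  moreover from this(2) have
    "ts \<in> (\<Union>us\<in>Poly_Mapping.keys (faces vs). Poly_Mapping.keys (subdivide (length us) us))"
    unfolding subdivision_def by (rule subsetD[OF keys_frag_extend])
  ultimately show ?thesis using that by (elim UN_E)
qed

lemma subdivide_keys:
  fixes vs :: "'a::real_normed_vector list"
  assumes "ws \<in> Poly_Mapping.keys (subdivide (length vs) vs)"
  shows "length ws = length vs \<and> set ws \<subseteq> convex hull set vs"
  using assms
proof (induction "length vs" arbitrary: vs ws rule: less_induct)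
  case less
  show ?case
  proof (cases "vs = []")
    case True
    with less.prems show ?thesis by (simp add: keys_frag_of)
  next
    case False
    obtain ts us where ts: "ws = barycentre vs # ts" and us: "us \<in> Poly_Mapping.keys (faces vs)"
      "ts \<in> Poly_Mapping.keys (subdivide (length us) us)"
      using less.prems(1) False by (rule keys_subdivideE)
    have k: "Suc (length us) = length vs" "set us \<subseteq> set vs" using keys_faces[OF us(1)] by auto
    have "length us < length vs" using k(1) by simp
    from less.hyps[OF this us(2)] have "length ts = length us" "set ts \<subseteq> convex hull set us"
      by blast+
    moreover have "convex hull set us \<subseteq> convex hull set vs" by (rule hull_mono[OF k(2)])
    ultimately show ?thesis
      using k(1) barycentre_in_convex_hull[OF False] unfolding ts(1) by simp
  qed
qed

text \<open>
  An edge of the subdivision either lies in the subdivision of a proper face, where induction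
  applies, or joins the barycentre to a point of the convex hull. Balls being convex, the distance
  from the barycentre to such a point is bounded by its largest distance to a vertex.
\<close>

lemma subdivide_mesh:
  fixes vs :: "'a::real_normed_vector list"
  assumes "ws \<in> Poly_Mapping.keys (subdivide (length vs) vs)" "length vs \<le> Suc N"
    and "\<forall>u\<in>set vs. \<forall>v\<in>set vs. dist u v \<le> D"
  shows "\<forall>x\<in>set ws. \<forall>y\<in>set ws. dist x y \<le> real N / real (Suc N) * D"
  using assms
proof (induction "length vs" arbitrary: vs ws rule: less_induct)
  case less
  define c where "c = real N / real (Suc N) * D"
  show ?case
  proof (cases "vs = []")
    case True
    with less.prems(1) show ?thesis by (simp add: keys_frag_of)
  next
    case False
    let ?b = "barycentre vs"
    obtain ts us where ts: "ws = barycentre vs # ts" and us: "us \<in> Poly_Mapping.keys (faces vs)"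
      "ts \<in> Poly_Mapping.keys (subdivide (length us) us)"
      using less.prems(1) False by (rule keys_subdivideE)
    have k: "Suc (length us) = length vs" "set us \<subseteq> set vs" using keys_faces[OF us(1)] by auto
    have "\<forall>u\<in>set us. \<forall>v\<in>set us. dist u v \<le> D" using less.prems(3) k(2) by blast
    then have in_ts: "\<forall>x\<in>set ts. \<forall>y\<in>set ts. dist x y \<le> c"
      unfolding c_def using less.hyps[of us ts] us(2) k(1) less.prems(2) by linarith
    have "hd vs \<in> set vs" using False by simp
    then have "dist (hd vs) (hd vs) \<le> D" using less.prems(3) by blast
    then have "0 \<le> D" by simp
    then have "0 \<le> c" unfolding c_def by (intro mult_nonneg_nonneg divide_nonneg_nonneg of_nat_0_le_iff)
    have "dist ?b v \<le> c" if "v \<in> set vs" for v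
      unfolding c_def by (rule dist_barycentre[OF _ less.prems(2) that]) (use less.prems(3) in blast)
    then have "convex hull set vs \<subseteq> cball ?b c"
      by (intro hull_minimal subsetI convex_cball) (simp only: mem_cball)
    moreover have "set ts \<subseteq> convex hull set vs"
      using subdivide_keys[OF us(2)] hull_mono[OF k(2), of convex] by blast
    ultimately have apex: "dist ?b y \<le> c" if "y \<in> set ts" for y
      using that unfolding mem_cball[symmetric] by blast
    then have "dist y ?b \<le> c" if "y \<in> set ts" for y using that by (simp only: dist_commute)
    with apex in_ts \<open>0 \<le> c\<close> show ?thesis
      unfolding ts(1) c_def[symmetric] by simp
  qed
qed

section \<open>A cochain that counts sign changes\<close>

definition pairing :: "('a list \<Rightarrow> int) \<Rightarrow> 'a chain \<Rightarrow> int" where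
  "pairing \<psi> c = (\<Sum>vs\<in>Poly_Mapping.keys c. Poly_Mapping.lookup c vs * \<psi> vs)"

text \<open>
  The pairing as a linear extension with values in the free group on one generator, from which it
  inherits additivity.
\<close>

lemma pairing_eq_lookup:
  "pairing \<psi> c = Poly_Mapping.lookup (frag_extend (\<lambda>vs. frag_cmul (\<psi> vs) (frag_of ())) c) ()"
  by (simp add: pairing_def frag_extend_def lookup_sum)

lemma pairing_0 [simp]: "pairing \<psi> 0 = 0"
  and pairing_of [simp]: "pairing \<psi> (frag_of vs) = \<psi> vs"
  and pairing_diff: "pairing \<psi> (c - d) = pairing \<psi> c - pairing \<psi> d"
  and pairing_cmul: "pairing \<psi> (frag_cmul k c) = k * pairing \<psi> c"
  by (simp_all add: pairing_eq_lookup frag_extend_diff frag_extend_cmul lookup_minus)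

lemma pairing_cong:
  "(\<And>vs. vs \<in> Poly_Mapping.keys c \<Longrightarrow> \<psi> vs = \<psi>' vs) \<Longrightarrow> pairing \<psi> c = pairing \<psi>' c"
  by (simp add: pairing_def)

lemma pairing_cochain_diff: "pairing (\<lambda>vs. \<psi> vs - \<psi>' vs) c = pairing \<psi> c - pairing \<psi>' c"
  by (simp add: pairing_def sum_subtractf right_diff_distrib)

lemma pairing_cochain_mult: "pairing (\<lambda>vs. k * \<psi> vs) c = k * pairing \<psi> c"
  by (simp add: pairing_def sum_distrib_left mult_ac)

lemma pairing_cone: "pairing \<psi> (cone_chain v c) = pairing (\<lambda>vs. \<psi> (v # vs)) c"
  by (induction c rule: chain_induct) (simp_all add: cone_diff pairing_diff)

lemma pairing_push: "pairing \<psi> (push h c) = pairing (\<lambda>vs. \<psi> (map h vs)) c"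
  by (induction c rule: chain_induct) (simp_all add: push_diff pairing_diff)

lemma pairing_boundary: "pairing \<psi> (boundary c) = pairing (\<lambda>vs. pairing \<psi> (faces vs)) c"
  by (induction c rule: chain_induct) (simp_all add: boundary_diff pairing_diff)

text \<open>
  If \<open>e i\<close> is the indicator of \<open>g\<^sub>i > 0\<close>, then \<open>crossing e vs\<close> is nonzero exactly if each function \<open>g\<^sub>i\<close>
  changes sign along the edge number \<open>i\<close> of the simplex. In topological terms it is the cup product of
  the coboundaries of \<open>e 0, e 1, \<dots>\<close>. On the quotient by the antipodal map, each of these coboundaries
  represents the generator of the first cohomology modulo \<open>2\<close> of projective space; the product is the
  top power of that generator, which is nonzero.
\<close>

fun crossing :: "(nat \<Rightarrow> 'a \<Rightarrow> int) \<Rightarrow> 'a list \<Rightarrow> int" where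
  "crossing e (u # v # vs) = (e 0 v - e 0 u) * crossing (\<lambda>i. e (Suc i)) (v # vs)"
| "crossing e vs = 1"

text \<open>
  The primitive of \<open>crossing\<close>: the first factor of the cup product is replaced by the function \<open>e 0\<close>
  of which it is the coboundary. Unlike \<open>crossing\<close>, it is not invariant up to
  sign under the antipodal map.
\<close>

definition precrossing :: "(nat \<Rightarrow> 'a \<Rightarrow> int) \<Rightarrow> 'a list \<Rightarrow> int" where
  "precrossing e vs = e 0 (hd vs) * crossing (\<lambda>i. e (Suc i)) vs"

lemma crossing_Cons:
  "vs \<noteq> [] \<Longrightarrow> crossing e (v # vs) = precrossing e vs - e 0 v * crossing (\<lambda>i. e (Suc i)) vs"
  by (cases vs) (auto simp: precrossing_def left_diff_distrib)

text \<open>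
  The cochain \<open>crossing e\<close> is closed, and it is the coboundary of \<open>precrossing e\<close>. The two claims need
  each other in the induction: the second for a simplex follows from the first for the same simplex
  with the sequence \<open>e\<close> shifted, and the first for a simplex follows from both claims for the
  face opposite its first vertex.
\<close>

lemma crossing_faces:
  assumes "2 \<le> length vs"
  shows "pairing (crossing e) (faces vs) = 0 \<and> pairing (precrossing e) (faces vs) = crossing e vs"
  using assms
proof (induction vs arbitrary: e)
  case (Cons v vs)
  have vs: "vs \<noteq> []" using Cons.prems by auto
  have coc: "pairing (crossing e) (faces (v # vs)) = 0" for e :: "nat \<Rightarrow> 'a \<Rightarrow> int"
  proof (cases "length vs = 1")
    case True
    then obtain u where "vs = [u]" by (auto simp: length_Suc_conv)
    then show ?thesis by (simp add: faces_Cons pairing_diff)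
  next
    case False
    with vs have len: "2 \<le> length vs" by (cases vs) (auto simp: Suc_le_eq)
    have "pairing (\<lambda>us. crossing e (v # us)) (faces vs)
        = pairing (\<lambda>us. precrossing e us - e 0 v * crossing (\<lambda>i. e (Suc i)) us) (faces vs)"
    proof (rule pairing_cong)
      fix us assume "us \<in> Poly_Mapping.keys (faces vs)"
      then have "us \<noteq> []" using keys_faces len by fastforce
      then show "crossing e (v # us) = precrossing e us - e 0 v * crossing (\<lambda>i. e (Suc i)) us"
        by (rule crossing_Cons)
    qed
    also have "\<dots> = crossing e vs"
      using Cons.IH[OF len] by (simp add: pairing_cochain_diff pairing_cochain_mult)
    finally show ?thesis by (simp add: faces_Cons pairing_diff pairing_cone)
  qed
  have "pairing (precrossing e) (faces (v # vs))
      = precrossing e vs - e 0 v * pairing (\<lambda>us. crossing (\<lambda>i. e (Suc i)) (v # us)) (faces vs)"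
    by (simp add: faces_Cons pairing_diff pairing_cone precrossing_def pairing_cochain_mult)
  also have "pairing (\<lambda>us. crossing (\<lambda>i. e (Suc i)) (v # us)) (faces vs) = crossing (\<lambda>i. e (Suc i)) vs"
    using coc[of "\<lambda>i. e (Suc i)"] by (simp add: faces_Cons pairing_diff pairing_cone)
  finally show ?case using coc[of e] crossing_Cons[OF vs] by simp
qed simp

lemma crossing_antipodal:
  assumes "\<And>i v. v \<in> set vs \<Longrightarrow> e i (- v) = 1 - e i v" "vs \<noteq> []"
  shows "crossing e (map uminus vs) = (- 1) ^ (length vs - 1) * crossing e vs"
  using assms
proof (induction e vs rule: crossing.induct)
  case (1 e u v vs)
  have "crossing (\<lambda>i. e (Suc i)) (map uminus (v # vs))
      = (- 1) ^ (length (v # vs) - 1) * crossing (\<lambda>i. e (Suc i)) (v # vs)"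
    by (rule 1) (use 1 in auto)
  moreover have "e 0 (- v) - e 0 (- u) = - (e 0 v - e 0 u)"
    using "1.prems"(1)[of u 0] "1.prems"(1)[of v 0] by simp
  ultimately show ?case by (simp add: left_diff_distrib right_diff_distrib mult.left_commute)
qed auto

text \<open>
  The chains \<open>T d\<close> play the role of hemispheres: the boundary of each is the sphere formed by the
  previous one and its antipode. By Stokes, the pairing of \<open>crossing e\<close> with \<open>T (Suc d)\<close> is the
  pairing of \<open>precrossing e\<close> with that sphere. On the antipode the factor \<open>e 0\<close> turns into \<open>1 - e 0\<close>,
  hence the two halves add up to an even number minus the pairing of the shifted cochain with \<open>T d\<close>. So the parity is the same in all dimensions, and in dimension \<open>0\<close> the value is \<open>1\<close>.
\<close>

lemma odd_crossing:
  fixes T :: "nat \<Rightarrow> 'a::group_add chain"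
  assumes T0: "T 0 = frag_of [x]"
    and TS: "\<And>d. boundary (T (Suc d)) = T d - frag_cmul ((- 1) ^ d) (push uminus (T d))"
    and keys: "\<And>d vs. d \<le> N \<Longrightarrow> vs \<in> Poly_Mapping.keys (T d) \<Longrightarrow> length vs = Suc d \<and> set vs \<subseteq> K"
    and e: "\<And>i v. v \<in> K \<Longrightarrow> e i (- v) = 1 - e i v"
    and "d \<le> N"
  shows "odd (pairing (crossing e) (T d))"
  using e \<open>d \<le> N\<close>
proof (induction d arbitrary: e)
  case 0
  then show ?case by (simp add: T0)
next
  case (Suc d)
  define e' where "e' = (\<lambda>i. e (Suc i))"
  have "pairing (crossing e) (T (Suc d)) = pairing (\<lambda>vs. pairing (precrossing e) (faces vs)) (T (Suc d))"
  proof (rule pairing_cong)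
    fix vs assume "vs \<in> Poly_Mapping.keys (T (Suc d))"
    then have "2 \<le> length vs" using keys[of "Suc d" vs] Suc.prems(2) by simp
    then show "crossing e vs = pairing (precrossing e) (faces vs)" using crossing_faces by metis
  qed
  also have "\<dots> = pairing (precrossing e) (T d)
      - (- 1) ^ d * pairing (\<lambda>vs. precrossing e (map uminus vs)) (T d)"
    by (simp flip: pairing_boundary add: TS pairing_diff pairing_cmul pairing_push)
  also have "(- 1) ^ d * pairing (\<lambda>vs. precrossing e (map uminus vs)) (T d)
      = pairing (\<lambda>vs. crossing e' vs - precrossing e vs) (T d)"
    unfolding pairing_cochain_mult[symmetric]
  proof (rule pairing_cong)
    fix vs assume "vs \<in> Poly_Mapping.keys (T d)"
    then have vs: "length vs = Suc d" "set vs \<subseteq> K" using keys[of d vs] Suc.prems(2) by auto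
    then have ne: "vs \<noteq> []" by auto
    have "crossing e' (map uminus vs) = (- 1) ^ d * crossing e' vs"
      using crossing_antipodal[of vs e'] Suc.prems(1) vs ne by (auto simp: e'_def)
    moreover have "e 0 (hd (map uminus vs)) = 1 - e 0 (hd vs)"
      using Suc.prems(1)[OF subsetD[OF vs(2) hd_in_set[OF ne]]] ne by (simp add: hd_map)
    ultimately show "(- 1) ^ d * precrossing e (map uminus vs) = crossing e' vs - precrossing e vs"
      unfolding precrossing_def e'_def[symmetric]
      by (simp only:) (simp add: left_diff_distrib right_diff_distrib mult.left_commute flip: power_mult_distrib mult.assoc)
  qed
  finally have "pairing (crossing e) (T (Suc d)) = 2 * pairing (precrossing e) (T d) - pairing (crossing e') (T d)"
    by (simp add: pairing_cochain_diff)
  moreover have "odd (pairing (crossing e') (T d))"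
    by (rule Suc.IH) (use Suc.prems in \<open>auto simp: e'_def\<close>)
  ultimately show ?case by simp
qed

section \<open>The cross-polytope and the Borsuk--Ulam theorem\<close>

text \<open>
  The chain formed by the facets of the cross-polytope with vertices \<open>\<plusminus> b 0, \<dots>, \<plusminus> b d\<close> that contain
  \<open>+ b d\<close>. The sign \<open>(- 1) ^ d\<close> is the one for which the chain coned over is a cycle.
\<close>

primrec hemisphere :: "(nat \<Rightarrow> 'a::real_vector) \<Rightarrow> nat \<Rightarrow> 'a chain" where
  "hemisphere b 0 = frag_of [b 0]"
| "hemisphere b (Suc d) =
     cone_chain (b (Suc d)) (hemisphere b d - frag_cmul ((- 1) ^ d) (push uminus (hemisphere b d)))"

lemma boundary_hemisphere:
  "boundary (hemisphere b (Suc d)) = hemisphere b d - frag_cmul ((- 1) ^ d) (push uminus (hemisphere b d))"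
proof -
  have "boundary (hemisphere b d - frag_cmul ((- 1) ^ d) (push uminus (hemisphere b d))) = 0"
  proof (induction d)
    case 0
    show ?case by (simp add: boundary_diff faces_Cons)
  next
    case (Suc d)
    let ?h = "hemisphere b d" and ?s = "(- 1) ^ d :: int"
    have "boundary (hemisphere b (Suc d)) = ?h - frag_cmul ?s (push uminus ?h)"
      by (simp add: boundary_cone Suc.IH)
    then have "boundary (hemisphere b (Suc d)
          - frag_cmul ((- 1) ^ Suc d) (push uminus (hemisphere b (Suc d))))
        = ?h - frag_cmul ?s (push uminus ?h) - frag_cmul (- ?s) (push uminus ?h - frag_cmul ?s ?h)"
      by (simp only: boundary_diff boundary_cmul boundary_push push_diff push_cmul push_push
          minus_minus push_id power_Suc mult_minus_left mult_1)
    also have "\<dots> = 0"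
      by (rule poly_mapping_eqI)
        (simp add: lookup_minus right_diff_distrib flip: mult.assoc power_mult_distrib)
    finally show ?case .
  qed
  then show ?thesis by (simp add: boundary_cone)
qed

text \<open>
  Each choice of signs gives one facet of the cross-polytope.
\<close>

definition facet_vertex_sets :: "(nat \<Rightarrow> 'a::real_vector) \<Rightarrow> nat \<Rightarrow> 'a set set" where
  "facet_vertex_sets b d = (\<lambda>s. (\<lambda>i. s i *\<^sub>R b i) ` {..d}) ` ({..d} \<rightarrow>\<^sub>E {1, - 1})"

lemma facet_vertex_setsI:
  assumes "\<And>i. i \<le> d \<Longrightarrow> s i = 1 \<or> s i = - 1"
  shows "(\<lambda>i. s i *\<^sub>R b i) ` {..d} \<in> facet_vertex_sets b d"
  unfolding facet_vertex_sets_def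
proof (rule image_eqI)
  show "restrict s {..d} \<in> {..d} \<rightarrow>\<^sub>E {1, - 1}" using assms by auto
qed auto

lemma facet_vertex_setsE:
  assumes "F \<in> facet_vertex_sets b d"
  obtains s where "\<forall>i\<le>d. s i = 1 \<or> s i = - 1" "F = (\<lambda>i. s i *\<^sub>R b i) ` {..d}"
proof -
  obtain s where s: "s \<in> {..d} \<rightarrow>\<^sub>E {1, - 1 :: real}" "F = (\<lambda>i. s i *\<^sub>R b i) ` {..d}"
    using assms unfolding facet_vertex_sets_def by blast
  have "\<forall>i\<le>d. s i = 1 \<or> s i = - 1" using PiE_mem[OF s(1)] by blast
  from that[OF this s(2)] show ?thesis .
qed

lemma uminus_facet_vertex_sets:
  assumes "F \<in> facet_vertex_sets b d" shows "uminus ` F \<in> facet_vertex_sets b d"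
proof -
  obtain s where s: "\<forall>i\<le>d. s i = 1 \<or> s i = - 1" "F = (\<lambda>i. s i *\<^sub>R b i) ` {..d}"
    using assms by (rule facet_vertex_setsE)
  have "uminus ` F = (\<lambda>i. (- s i) *\<^sub>R b i) ` {..d}" by (simp add: s(2) image_image)
  also have "\<dots> \<in> facet_vertex_sets b d" by (rule facet_vertex_setsI) (use s(1) in force)
  finally show ?thesis .
qed

lemma insert_facet_vertex_sets:
  assumes "F \<in> facet_vertex_sets b d" shows "insert (b (Suc d)) F \<in> facet_vertex_sets b (Suc d)"
proof -
  obtain s where s: "\<forall>i\<le>d. s i = 1 \<or> s i = - 1" "F = (\<lambda>i. s i *\<^sub>R b i) ` {..d}"
    using assms by (rule facet_vertex_setsE)
  have "insert (b (Suc d)) F = (\<lambda>i. (s(Suc d := 1)) i *\<^sub>R b i) ` {..Suc d}"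
    by (simp add: s(2) atMost_Suc)
  also have "\<dots> \<in> facet_vertex_sets b (Suc d)" by (rule facet_vertex_setsI) (use s(1) in auto)
  finally show ?thesis .
qed

lemma keys_hemisphere:
  assumes "vs \<in> Poly_Mapping.keys (hemisphere b d)"
  shows "length vs = Suc d \<and> (\<exists>F\<in>facet_vertex_sets b d. set vs \<subseteq> F)"
  using assms
proof (induction d arbitrary: vs)
  case 0
  have "{b 0} \<in> facet_vertex_sets b 0" using facet_vertex_setsI[of 0 "\<lambda>_. 1" b] by simp
  then show ?case using 0 by (auto simp: keys_frag_of)
next
  case (Suc d)
  let ?h = "hemisphere b d" and ?a = "frag_cmul ((- 1) ^ d) (push uminus (hemisphere b d))"
  obtain us where us: "vs = b (Suc d) # us" "us \<in> Poly_Mapping.keys (?h - ?a)"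
    using subsetD[OF keys_cone Suc.prems[unfolded hemisphere.simps]] by (rule imageE)
  have "us \<in> Poly_Mapping.keys ?h \<union> Poly_Mapping.keys ?a" using us(2) by (rule subsetD[OF keys_diff])
  moreover have "Poly_Mapping.keys ?a \<subseteq> map uminus ` Poly_Mapping.keys ?h"
    using order_trans[OF keys_cmul keys_push] .
  ultimately have "us \<in> Poly_Mapping.keys ?h \<or> (\<exists>ts\<in>Poly_Mapping.keys ?h. us = map uminus ts)" by blast
  then have "length us = Suc d \<and> (\<exists>F\<in>facet_vertex_sets b d. set us \<subseteq> F)"
  proof
    assume "\<exists>ts\<in>Poly_Mapping.keys ?h. us = map uminus ts"
    then obtain ts F where "us = map uminus ts" "length ts = Suc d" "F \<in> facet_vertex_sets b d" "set ts \<subseteq> F"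
      using Suc.IH by blast
    then show ?thesis using uminus_facet_vertex_sets[of F b d] by (auto intro!: bexI[of _ "uminus ` F"])
  qed (rule Suc.IH)
  then obtain F where "length us = Suc d" "F \<in> facet_vertex_sets b d" "set us \<subseteq> F" by blast
  then show ?case using insert_facet_vertex_sets[of F b d] us(1)
    by (auto intro!: bexI[of _ "insert (b (Suc d)) F"])
qed

text \<open>
  The boundary of the cross-polytope; the \<open>b i\<close> need not be orthogonal.
\<close>

definition cross_polytope :: "(nat \<Rightarrow> 'a::real_vector) \<Rightarrow> nat \<Rightarrow> 'a set" where
  "cross_polytope b d = (\<Union>F\<in>facet_vertex_sets b d. convex hull F)"

lemma finite_facet_vertex_sets: "finite (facet_vertex_sets b d)"
  unfolding facet_vertex_sets_def by (intro finite_imageI finite_PiE) auto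

lemma compact_cross_polytope:
  fixes b :: "nat \<Rightarrow> 'a::real_normed_vector"
  shows "compact (cross_polytope b d)"
  unfolding cross_polytope_def
proof (rule compact_UN[OF finite_facet_vertex_sets])
  fix F assume "F \<in> facet_vertex_sets b d"
  then have "finite F" unfolding facet_vertex_sets_def by auto
  then show "compact (convex hull F)" by (rule finite_imp_compact_convex_hull)
qed

lemma cross_polytope_subset_span: "cross_polytope b d \<subseteq> span (b ` {..d})"
  unfolding cross_polytope_def
proof (intro UN_least hull_minimal)
  fix F assume "F \<in> facet_vertex_sets b d"
  then show "F \<subseteq> span (b ` {..d})"
    unfolding facet_vertex_sets_def by (auto intro!: span_scale[OF span_base])
qed (rule subspace_imp_convex[OF subspace_span])

text \<open>
  A point of a facet is a combination of the \<open>b i\<close> whose coefficients have absolute values summing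
  to \<open>1\<close>, so it is not zero if the \<open>b i\<close> are independent.
\<close>

lemma zero_notin_cross_polytope:
  assumes indep: "\<And>a. (\<Sum>i\<le>d. a i *\<^sub>R b i) = 0 \<Longrightarrow> \<forall>i\<le>d. a i = 0"
  shows "0 \<notin> cross_polytope b d"
proof
  assume "0 \<in> cross_polytope b d"
  then obtain F where F: "F \<in> facet_vertex_sets b d" "0 \<in> convex hull F" unfolding cross_polytope_def by blast
  obtain s where s: "\<forall>i\<le>d. s i = 1 \<or> s i = - 1" "F = (\<lambda>i. s i *\<^sub>R b i) ` {..d}"
    using F(1) by (rule facet_vertex_setsE)
  define C where "C = {\<Sum>i\<le>d. t i *\<^sub>R s i *\<^sub>R b i | t. sum t {..d} = (1::real)}"
  have "convex hull F \<subseteq> C"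
  proof (rule hull_minimal)
    show "F \<subseteq> C"
    proof
      fix x assume "x \<in> F"
      then obtain j where j: "j \<le> d" "x = s j *\<^sub>R b j" using s(2) by auto
      have "(\<Sum>i\<le>d. (if i = j then 1 else 0) *\<^sub>R s i *\<^sub>R b i) = x"
      proof -
        have "(\<Sum>i\<le>d. (if i = j then 1 else 0) *\<^sub>R s i *\<^sub>R b i) = (\<Sum>i\<le>d. if i = j then s j *\<^sub>R b j else 0)"
          by (rule sum.cong) auto
        then show ?thesis using j by simp
      qed
      moreover have "(\<Sum>i\<le>d. (if i = j then 1 else 0)) = (1::real)" using j by simp
      ultimately show "x \<in> C"
        unfolding C_def by (intro CollectI exI[of _ "\<lambda>i. if i = j then 1 else 0"]) simp
    qed
    show "convex C"
    proof (rule convexI)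
      fix x y u v assume xy: "x \<in> C" "y \<in> C" and uv: "0 \<le> u" "0 \<le> v" "u + v = (1::real)"
      obtain t t' where t: "sum t {..d} = (1::real)" "x = (\<Sum>i\<le>d. t i *\<^sub>R s i *\<^sub>R b i)"
        "sum t' {..d} = (1::real)" "y = (\<Sum>i\<le>d. t' i *\<^sub>R s i *\<^sub>R b i)"
        using xy unfolding C_def by blast
      have "u *\<^sub>R x + v *\<^sub>R y = (\<Sum>i\<le>d. (u * t i + v * t' i) *\<^sub>R s i *\<^sub>R b i)"
        unfolding t by (simp add: scaleR_sum_right scaleR_left_distrib distrib_right mult.assoc flip: sum.distrib)
      moreover have "(\<Sum>i\<le>d. u * t i + v * t' i) = 1"
        using t uv by (simp add: sum.distrib flip: sum_distrib_left)
      ultimately show "u *\<^sub>R x + v *\<^sub>R y \<in> C"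
        unfolding C_def by (intro CollectI exI[of _ "\<lambda>i. u * t i + v * t' i"]) simp
    qed
  qed
  with F(2) obtain t where t: "sum t {..d} = (1::real)" "(\<Sum>i\<le>d. (t i * s i) *\<^sub>R b i) = 0"
    unfolding C_def by auto
  have "t i = 0" if "i \<le> d" for i using indep[OF t(2)] s(1) that by force
  then have "sum t {..d} = 0" by simp
  with t(1) show False by simp
qed

lemma crossing_nonzero:
  "crossing e vs \<noteq> 0 \<Longrightarrow> Suc i < length vs \<Longrightarrow> e i (vs ! i) \<noteq> e i (vs ! Suc i)"
proof (induction e vs arbitrary: i rule: crossing.induct)
  case (1 e u v vs)
  then show ?case by (cases i) auto
qed auto

definition subdivided_hemisphere :: "(nat \<Rightarrow> 'a::real_vector) \<Rightarrow> nat \<Rightarrow> nat \<Rightarrow> 'a chain" where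
  "subdivided_hemisphere b r d = (subdivision ^^ r) (hemisphere b d)"

lemma boundary_subdivided_hemisphere:
  "boundary (subdivided_hemisphere b r (Suc d)) = subdivided_hemisphere b r d
     - frag_cmul ((- 1) ^ d) (push uminus (subdivided_hemisphere b r d))"
  unfolding subdivided_hemisphere_def
proof (induction r)
  case 0
  show ?case by (simp only: funpow_0 boundary_hemisphere)
next
  case (Suc r)
  then show ?case
    by (simp add: boundary_subdivision subdivision_diff subdivision_cmul subdivision_uminus)
qed

lemma subdivided_hemisphere_0: "subdivided_hemisphere b r 0 = frag_of [b 0]"
  unfolding subdivided_hemisphere_def
  by (induction r) (simp_all add: faces_Cons barycentre_def)

lemma keys_subdivided_hemisphere:
  fixes b :: "nat \<Rightarrow> 'a::real_normed_vector"
  assumes D: "\<And>u v. u \<in> cross_polytope b d \<Longrightarrow> v \<in> cross_polytope b d \<Longrightarrow> dist u v \<le> D"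
    and "vs \<in> Poly_Mapping.keys (subdivided_hemisphere b r d)"
  shows "length vs = Suc d \<and> set vs \<subseteq> cross_polytope b d \<and>
    (\<forall>u\<in>set vs. \<forall>v\<in>set vs. dist u v \<le> (real d / real (Suc d)) ^ r * D)"
proof -
  have "length vs = Suc d \<and> (\<exists>F\<in>facet_vertex_sets b d. set vs \<subseteq> convex hull F) \<and>
    (\<forall>u\<in>set vs. \<forall>v\<in>set vs. dist u v \<le> (real d / real (Suc d)) ^ r * D)"
    using assms(2) unfolding subdivided_hemisphere_def
  proof (induction r arbitrary: vs)
    case 0
    then have "length vs = Suc d" and "\<exists>F\<in>facet_vertex_sets b d. set vs \<subseteq> F"
      using keys_hemisphere by auto
    then obtain F where F: "length vs = Suc d" "F \<in> facet_vertex_sets b d" "set vs \<subseteq> F" by blast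
    then have "set vs \<subseteq> convex hull F" using hull_subset[of F convex] by blast
    moreover from this have "set vs \<subseteq> cross_polytope b d" using F(2) unfolding cross_polytope_def by blast
    ultimately show ?case using F(1,2) D by (auto simp: subset_iff)
  next
    case (Suc r)
    have "vs \<in> Poly_Mapping.keys (subdivision ((subdivision ^^ r) (hemisphere b d)))"
      using Suc.prems by simp
    then obtain us where us: "us \<in> Poly_Mapping.keys ((subdivision ^^ r) (hemisphere b d))"
      "vs \<in> Poly_Mapping.keys (subdivide (length us) us)"
      unfolding subdivision_def by (rule UN_E[OF subsetD[OF keys_frag_extend]])
    from Suc.IH[OF us(1)] obtain F where F: "length us = Suc d" "F \<in> facet_vertex_sets b d"
      "set us \<subseteq> convex hull F"
      "\<forall>u\<in>set us. \<forall>v\<in>set us. dist u v \<le> (real d / real (Suc d)) ^ r * D" by blast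
    have "convex hull (set us) \<subseteq> convex hull F"
      by (intro hull_minimal F(3) convex_convex_hull)
    then have "length vs = Suc d" "set vs \<subseteq> convex hull F"
      using subdivide_keys[OF us(2)] F(1) by auto
    moreover have "\<forall>u\<in>set vs. \<forall>v\<in>set vs. dist u v \<le> real d / real (Suc d) * ((real d / real (Suc d)) ^ r * D)"
      by (rule subdivide_mesh[OF us(2) _ F(4)]) (simp add: F(1))
    ultimately show ?case using F(2) by (auto simp: mult.assoc)
  qed
  then show ?thesis unfolding cross_polytope_def by blast
qed

lemma cross_polytope_mono:
  assumes "d \<le> n" shows "cross_polytope b d \<subseteq> cross_polytope b n"
  using assms
proof (induction n rule: dec_induct)
  case (step n)
  have "cross_polytope b n \<subseteq> cross_polytope b (Suc n)"
  proof
    fix x assume "x \<in> cross_polytope b n"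
    then obtain F where F: "F \<in> facet_vertex_sets b n" "x \<in> convex hull F" unfolding cross_polytope_def by blast
    have "x \<in> convex hull insert (b (Suc n)) F"
      by (rule subsetD[OF hull_mono[OF subset_insertI] F(2)])
    then show "x \<in> cross_polytope b (Suc n)"
      using insert_facet_vertex_sets[OF F(1)] unfolding cross_polytope_def by blast
  qed
  with step.IH show ?case by blast
qed simp

text \<open>
  Existence follows from parity: the pairing is odd, so some term of it is nonzero.
\<close>

lemma crossing_simplex:
  fixes b :: "nat \<Rightarrow> 'a::real_normed_vector"
  assumes "\<And>i v. v \<in> cross_polytope b n \<Longrightarrow> e i (- v) = 1 - e i v"
  obtains vs where "vs \<in> Poly_Mapping.keys (subdivided_hemisphere b r n)" "crossing e vs \<noteq> 0"
proof -
  have "odd (pairing (crossing e) (subdivided_hemisphere b r n))"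
  proof (rule odd_crossing[OF subdivided_hemisphere_0 boundary_subdivided_hemisphere])
    fix d vs assume d: "d \<le> n" and vs: "vs \<in> Poly_Mapping.keys (subdivided_hemisphere b r d)"
    obtain D where "\<And>u v. u \<in> cross_polytope b d \<Longrightarrow> v \<in> cross_polytope b d \<Longrightarrow> dist u v \<le> D"
      using compact_imp_bounded[OF compact_cross_polytope, of b d] bounded_two_points by metis
    from keys_subdivided_hemisphere[OF this vs] cross_polytope_mono[OF d]
    show "length vs = Suc d \<and> set vs \<subseteq> cross_polytope b n" by blast
  qed (use assms in auto)
  then have "pairing (crossing e) (subdivided_hemisphere b r n) \<noteq> 0" by auto
  then show ?thesis using that unfolding pairing_def by (metis (no_types, lifting) mult_eq_0_iff sum.neutral)
qed

text \<open>
  Suppose that \<open>g\<close> has no zero. By compactness the sum of the absolute values of its coordinates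
  has a positive minimum. A fine subdivision contains a simplex on which every coordinate of \<open>g\<close> changes sign;
  by uniform continuity all coordinates are small at each of its vertices, a contradiction.
\<close>

theorem borsuk_ulam:
  fixes b :: "nat \<Rightarrow> 'a::real_normed_vector" and g :: "'a \<Rightarrow> nat \<Rightarrow> real"
  assumes indep: "\<And>a. (\<Sum>i\<le>n. a i *\<^sub>R b i) = 0 \<Longrightarrow> \<forall>i\<le>n. a i = 0"
    and cont: "\<And>i. i < n \<Longrightarrow> continuous_on (cross_polytope b n) (\<lambda>v. g v i)"
    and odd: "\<And>v i. v \<in> cross_polytope b n \<Longrightarrow> i < n \<Longrightarrow> g (- v) i = - g v i"
  obtains v where "v \<in> cross_polytope b n" "\<And>i. i < n \<Longrightarrow> g v i = 0"
proof -
  let ?K = "cross_polytope b n"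
  have "\<exists>v\<in>?K. \<forall>i<n. g v i = 0"
  proof (rule ccontr)
    assume nozero: "\<not> (\<exists>v\<in>?K. \<forall>i<n. g v i = 0)"
    define m where "m v = (\<Sum>i<n. \<bar>g v i\<bar>)" for v
    have ne: "?K \<noteq> {}"
      using facet_vertex_setsI[of n "\<lambda>_. 1" b] unfolding cross_polytope_def by force
    have "continuous_on ?K m" unfolding m_def by (intro continuous_intros cont) auto
    then obtain x where x: "x \<in> ?K" "\<And>v. v \<in> ?K \<Longrightarrow> m x \<le> m v"
      using continuous_attains_inf[OF compact_cross_polytope ne] by metis
    have "m x > 0"
    proof -
      obtain i where "i < n" "g x i \<noteq> 0" using nozero x(1) by blast
      then show ?thesis unfolding m_def by (intro sum_pos2[of _ i]) auto
    qed
    \<comment> \<open>The sum of the \<open>n\<close> coordinates, each at most \<open>2 * \<epsilon>\<close>, stays below the minimum \<open>m x\<close>.\<close>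
    define \<epsilon> where "\<epsilon> = m x / real (Suc (2 * n))"
    have "\<epsilon> > 0" using \<open>m x > 0\<close> by (simp add: \<epsilon>_def)
    have "\<exists>\<delta>>0. \<forall>u\<in>?K. \<forall>v\<in>?K. dist u v < \<delta> \<longrightarrow> dist (g u i) (g v i) < \<epsilon>" if "i < n" for i
      using compact_uniformly_continuous[OF cont[OF that] compact_cross_polytope] \<open>\<epsilon> > 0\<close>
      unfolding uniformly_continuous_on_def by (metis dist_commute)
    then obtain \<delta> where \<delta>: "\<And>i. i < n \<Longrightarrow> \<delta> i > 0"
      "\<And>i u v. i < n \<Longrightarrow> u \<in> ?K \<Longrightarrow> v \<in> ?K \<Longrightarrow> dist u v < \<delta> i \<Longrightarrow> dist (g u i) (g v i) < \<epsilon>"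
      by metis
    define \<eta> where "\<eta> = Min (insert 1 (\<delta> ` {..<n}))"
    have "\<eta> > 0" using \<delta>(1) by (auto simp: \<eta>_def)
    have \<eta>: "\<eta> \<le> \<delta> i" if "i < n" for i using that by (auto simp: \<eta>_def)
    obtain D where D: "\<And>u v. u \<in> ?K \<Longrightarrow> v \<in> ?K \<Longrightarrow> dist u v \<le> D"
      using compact_imp_bounded[OF compact_cross_polytope, of b n] bounded_two_points by metis
    have "(\<lambda>r. (real n / real (Suc n)) ^ r * D) \<longlonglongrightarrow> 0 * D"
      by (intro tendsto_intros LIMSEQ_power_zero) simp
    then obtain r where r: "(real n / real (Suc n)) ^ r * D < \<eta>"
      using order_tendstoD(2)[of _ "0 * D" sequentially \<eta>] \<open>\<eta> > 0\<close>
      by (auto simp: eventually_sequentially)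
    \<comment> \<open>The indicator of \<open>g v i > 0\<close>. Where \<open>g v i\<close> vanishes, exactly one point of each antipodal pair
      must receive the value \<open>1\<close>. The choice operator selects it, since \<open>{v, - v}\<close> is the same set for
      both points of the pair.\<close>
    define e :: "nat \<Rightarrow> 'a \<Rightarrow> int" where
      "e i v = (if i < n \<and> g v i \<noteq> 0 then if g v i > 0 then 1 else 0
                else if v = (SOME u. u \<in> {v, - v}) then 1 else 0)" for i v
    have anti: "e i (- v) = 1 - e i v" if "v \<in> ?K" for i v
    proof -
      have "v \<noteq> 0" using zero_notin_cross_polytope[of b n, OF indep] that by blast
      then have "v \<noteq> - v" by (metis real_vector.scale_zero_left add.inverse_neutral eq_neg_iff_add_eq_0 scaleR_2 scaleR_eq_0_iff zero_neq_numeral)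
      moreover have "(SOME u. u \<in> {v, - v}) \<in> {v, - v}" by (rule someI[of _ v]) simp
      moreover have "{- v, - (- v)} = {v, - v}" by auto
      ultimately have "(- v = (SOME u. u \<in> {- v, - (- v)})) \<longleftrightarrow> v \<noteq> (SOME u. u \<in> {v, - v})"
        by (metis insertE singletonD)
      then show ?thesis using odd[OF that, of i] by (auto simp: e_def)
    qed
    obtain vs where vs: "vs \<in> Poly_Mapping.keys (subdivided_hemisphere b r n)" "crossing e vs \<noteq> 0"
      using crossing_simplex[of b n e r] anti by blast
    have len: "length vs = Suc n" and K: "set vs \<subseteq> ?K"
      and mesh: "\<And>u v. u \<in> set vs \<Longrightarrow> v \<in> set vs \<Longrightarrow> dist u v < \<eta>"
      using keys_subdivided_hemisphere[OF D vs(1)] r by force+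
    let ?v = "vs ! 0"
    have v0: "?v \<in> set vs" using len by simp
    have small: "\<bar>g ?v i\<bar> \<le> 2 * \<epsilon>" if i: "i < n" for i
    proof -
      let ?u = "vs ! i" and ?w = "vs ! Suc i"
      have mem: "?u \<in> set vs" "?w \<in> set vs" using i len by auto
      have close: "\<bar>g y i - g z i\<bar> < \<epsilon>" if "y \<in> set vs" "z \<in> set vs" for y z
        using \<delta>(2)[OF i, of y z] mesh[OF that] \<eta>[OF i] K that by (force simp: dist_real_def)
      have "e i ?u \<noteq> e i ?w" using crossing_nonzero[OF vs(2)] i len by simp
      then have "\<not> (g ?u i > 0 \<and> g ?w i > 0)" "\<not> (g ?u i < 0 \<and> g ?w i < 0)"
        using i by (auto simp: e_def)
      then show ?thesis
        using close[OF mem] close[OF v0 mem(1)] close[OF v0 mem(2)] by argo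
    qed
    have "m x \<le> m ?v" using x(2) v0 K by blast
    also have "\<dots> \<le> (\<Sum>i<n. 2 * \<epsilon>)" unfolding m_def by (intro sum_mono small) simp
    also have "\<dots> = real (2 * n) * \<epsilon>" by simp
    also have "\<dots> < real (Suc (2 * n)) * \<epsilon>" using \<open>\<epsilon> > 0\<close> by (intro mult_strict_right_mono) auto
    also have "\<dots> = m x" by (simp add: \<epsilon>_def del: of_nat_Suc)
    finally show False by simp
  qed
  then show ?thesis using that by blast
qed

section \<open>Nodal domains\<close>

text \<open>
  The edges that a strong nodal domain walk may use, so that strong nodal domains are the classes of
  the reflexive transitive closure.
\<close>

definition positive_edges :: "'v::finite set set \<Rightarrow> ('v set \<Rightarrow> real) \<Rightarrow> real ^ 'v \<Rightarrow> ('v \<times> 'v) set" where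
  "positive_edges E \<sigma> f = {(x, y). {x, y} \<in> E \<and> f $ x * \<sigma> {x, y} * f $ y > 0}"

lemma sym_positive_edges: "sym (positive_edges E \<sigma> f)"
  by (auto simp: sym_def positive_edges_def insert_commute mult_ac)

lemma positive_edges_nonzero:
  "(x, y) \<in> positive_edges E \<sigma> f \<Longrightarrow> x \<in> nonzero_set f \<and> y \<in> nonzero_set f"
  by (auto simp: positive_edges_def nonzero_set_def)

lemma all_index_Cons:
  "(\<forall>i. Suc i < length (x # y # ys) \<longrightarrow> P ((x # y # ys) ! i) ((x # y # ys) ! Suc i)) \<longleftrightarrow>
     P x y \<and> (\<forall>i. Suc i < length (y # ys) \<longrightarrow> P ((y # ys) ! i) ((y # ys) ! Suc i))"
  (is "?L \<longleftrightarrow> P x y \<and> ?R")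
proof
  assume L: ?L
  show "P x y \<and> ?R" using L[rule_format, of 0] L[rule_format, of "Suc _"] by simp
next
  assume R: "P x y \<and> ?R"
  show ?L
  proof (intro allI impI)
    fix i assume "Suc i < length (x # y # ys)"
    with R show "P ((x # y # ys) ! i) ((x # y # ys) ! Suc i)" by (cases i) auto
  qed
qed

lemma strong_walk_single [simp]: "strong_walk E \<sigma> f [x]"
  by (simp add: strong_walk_def)

lemma strong_walk_Cons:
  "strong_walk E \<sigma> f (x # y # ys) \<longleftrightarrow> (x, y) \<in> positive_edges E \<sigma> f \<and> strong_walk E \<sigma> f (y # ys)"
  unfolding strong_walk_def
  using all_index_Cons[of x y ys "\<lambda>x y. {x, y} \<in> E \<and> f $ x * \<sigma> {x, y} * f $ y > 0"]
  by (simp only: positive_edges_def mem_Collect_eq prod.case) simp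

lemma strong_walk_rtrancl:
  "strong_walk E \<sigma> f xs \<Longrightarrow> (hd xs, last xs) \<in> (positive_edges E \<sigma> f)\<^sup>*"
proof (induction xs rule: induct_list012)
  case 1 then show ?case by (simp add: strong_walk_def)
next
  case (3 x y ys)
  then show ?case unfolding strong_walk_Cons by (auto intro: converse_rtrancl_into_rtrancl)
qed simp

lemma rtrancl_strong_walk:
  assumes "(x, y) \<in> (positive_edges E \<sigma> f)\<^sup>*"
  shows "\<exists>xs. strong_walk E \<sigma> f xs \<and> hd xs = x \<and> last xs = y"
  using assms
proof (induction rule: converse_rtrancl_induct)
  case base
  show ?case by (intro exI[of _ "[y]"]) simp
next
  case (step x z)
  then obtain xs where xs: "strong_walk E \<sigma> f xs" "hd xs = z" "last xs = y" by blast
  from xs(1) have "xs \<noteq> []" by (simp add: strong_walk_def)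
  with xs step(1) show ?case
    by (intro exI[of _ "x # xs"]) (cases xs; simp add: strong_walk_Cons)
qed

lemma strong_equiv_eq:
  "strong_equiv E \<sigma> f = (positive_edges E \<sigma> f)\<^sup>* \<inter> nonzero_set f \<times> nonzero_set f"
proof -
  have "(x = y \<or> (\<exists>xs. strong_walk E \<sigma> f xs \<and> hd xs = x \<and> last xs = y)) \<longleftrightarrow>
      (x, y) \<in> (positive_edges E \<sigma> f)\<^sup>*" for x y
    using strong_walk_rtrancl[of E \<sigma> f] rtrancl_strong_walk[of x y E \<sigma> f] by auto
  then show ?thesis unfolding strong_equiv_def by auto
qed

lemma equiv_strong_equiv: "equiv (nonzero_set f) (strong_equiv E \<sigma> f)"
  unfolding strong_equiv_eq
proof (rule equivI)
  show "sym ((positive_edges E \<sigma> f)\<^sup>* \<inter> nonzero_set f \<times> nonzero_set f)"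
    using sym_rtrancl[OF sym_positive_edges[of E \<sigma> f]] unfolding sym_def by blast
  show "trans ((positive_edges E \<sigma> f)\<^sup>* \<inter> nonzero_set f \<times> nonzero_set f)"
    by (rule transI) (auto intro: rtrancl_trans)
qed (auto simp: refl_on_def)

text \<open>
  Since \<open>y\<close> is not a zero of \<open>f\<close>, the only new pair of consecutive nonzero entries of the walk is
  the pair \<open>x\<close>, \<open>y\<close>, which is positive by assumption.
\<close>

lemma weak_walk_Cons:
  assumes xy: "(x, y) \<in> positive_edges E \<sigma> f" and walk: "weak_walk E \<sigma> f (y # ys)"
  shows "weak_walk E \<sigma> f (x # y # ys)"
  unfolding weak_walk_def
proof (intro conjI allI impI)
  let ?xs = "x # y # ys"
  show "2 \<le> length ?xs" by simp
  show "{?xs ! i, ?xs ! Suc i} \<in> E" if "Suc i < length ?xs" for i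
    using xy walk that unfolding weak_walk_def positive_edges_def by (cases i) auto
  fix i j
  assume ij: "i < j \<and> j < length ?xs \<and> f $ (?xs ! i) \<noteq> 0 \<and> f $ (?xs ! j) \<noteq> 0 \<and>
    (\<forall>l. i < l \<and> l < j \<longrightarrow> f $ (?xs ! l) = 0)"
  then obtain j' where j': "j = Suc j'" by (cases j) auto
  show "0 < f $ (?xs ! i) * (\<Prod>l = i..<j. \<sigma> {?xs ! l, ?xs ! Suc l}) * f $ (?xs ! j)"
  proof (cases i)
    case 0
    have "f $ (?xs ! 1) \<noteq> 0" using xy by (auto simp: positive_edges_def)
    with ij 0 have "\<not> 1 < j" by force
    then have "j = 1" using ij by linarith
    then show ?thesis using 0 xy by (simp add: positive_edges_def)
  next
    case (Suc i')
    let ?zs = "y # ys"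
    have W: "0 < f $ (?zs ! a) * (\<Prod>l = a..<c. \<sigma> {?zs ! l, ?zs ! Suc l}) * f $ (?zs ! c)"
      if "a < c" "c < length ?zs" "f $ (?zs ! a) \<noteq> 0" "f $ (?zs ! c) \<noteq> 0"
        "\<forall>l. a < l \<and> l < c \<longrightarrow> f $ (?zs ! l) = 0" for a c
      using walk that unfolding weak_walk_def by blast
    have "0 < f $ (?zs ! i') * (\<Prod>l = i'..<j'. \<sigma> {?zs ! l, ?zs ! Suc l}) * f $ (?zs ! j')"
    proof (rule W)
      show "i' < j'" "j' < length ?zs" using ij Suc j' by simp_all
      show "f $ (?zs ! i') \<noteq> 0" "f $ (?zs ! j') \<noteq> 0"
        using ij unfolding Suc j' nth_Cons_Suc by blast+
      show "\<forall>l. i' < l \<and> l < j' \<longrightarrow> f $ (?zs ! l) = 0"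
      proof (intro allI impI)
        fix l assume "i' < l \<and> l < j'"
        then have "i < Suc l \<and> Suc l < j" using Suc j' by simp
        then have "f $ (?xs ! Suc l) = 0" using ij by blast
        then show "f $ (?zs ! l) = 0" by (simp only: nth_Cons_Suc)
      qed
    qed
    then show ?thesis
      unfolding Suc j' by (simp only: prod.shift_bounds_Suc_ivl nth_Cons_Suc)
  qed
qed

lemma strong_weak_trans:
  assumes "(x, y) \<in> (positive_edges E \<sigma> f)\<^sup>*" "(y, z) \<in> weak_equiv E \<sigma> f"
  shows "(x, z) \<in> weak_equiv E \<sigma> f"
  using assms(1)
proof (induction rule: converse_rtrancl_induct)
  case base
  show ?case by (rule assms(2))
next
  case (step u v)
  have uv: "u \<in> nonzero_set f" "v \<in> nonzero_set f" using positive_edges_nonzero[OF step(1)] by auto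
  have z: "z \<in> nonzero_set f" using assms(2) by (simp add: weak_equiv_def)
  from step.IH have "v = z \<or> (\<exists>xs. weak_walk E \<sigma> f xs \<and> hd xs = v \<and> last xs = z)"
    by (simp add: weak_equiv_def)
  then have "\<exists>xs. weak_walk E \<sigma> f xs \<and> hd xs = u \<and> last xs = z"
  proof
    assume "v = z"
    have "weak_walk E \<sigma> f [u, v]"
      unfolding weak_walk_def
    proof (intro conjI allI impI)
      fix i j assume "i < j \<and> j < length [u, v] \<and> f $ ([u, v] ! i) \<noteq> 0 \<and> f $ ([u, v] ! j) \<noteq> 0 \<and>
        (\<forall>l. i < l \<and> l < j \<longrightarrow> f $ ([u, v] ! l) = 0)"
      then have "i = 0" "j = 1" by auto
      then show "0 < f $ ([u, v] ! i) * (\<Prod>l = i..<j. \<sigma> {[u, v] ! l, [u, v] ! Suc l}) * f $ ([u, v] ! j)"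
        using step(1) by (simp add: positive_edges_def)
    qed (use step(1) in \<open>auto simp: positive_edges_def\<close>)
    then show ?thesis using \<open>v = z\<close> by (intro exI[of _ "[u, v]"]) simp
  next
    assume "\<exists>xs. weak_walk E \<sigma> f xs \<and> hd xs = v \<and> last xs = z"
    then obtain xs where xs: "weak_walk E \<sigma> f xs" "hd xs = v" "last xs = z" by blast
    then obtain ys where ys: "xs = v # ys" by (cases xs) (auto simp: weak_walk_def)
    have "weak_walk E \<sigma> f (u # v # ys)" by (rule weak_walk_Cons[OF step(1)]) (use xs ys in simp)
    then show ?thesis using xs ys by (intro exI[of _ "u # v # ys"]) simp
  qed
  then show ?case using uv z by (simp add: weak_equiv_def)
qed

text \<open>
  The weak class of a point is the union of the weak classes of the points in its strong class, so
  it is determined by the strong class.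
\<close>

lemma num_weak_le_num_strong:
  "num_weak_nodal_domains E \<sigma> f \<le> num_strong_nodal_domains E \<sigma> f"
proof -
  let ?W = "weak_equiv E \<sigma> f" and ?S = "strong_equiv E \<sigma> f" and ?N = "nonzero_set f"
  have W: "?W `` {x} = ?W `` (?S `` {x})" if "x \<in> ?N" for x
    using that strong_weak_trans[of x _ E \<sigma> f] unfolding strong_equiv_eq by auto
  have "?N // ?W \<subseteq> (\<lambda>C. ?W `` C) ` (?N // ?S)"
  proof
    fix C assume "C \<in> ?N // ?W"
    then obtain x where x: "x \<in> ?N" "C = ?W `` {x}" by (auto elim: quotientE)
    then have "C = ?W `` (?S `` {x})" using W by simp
    then show "C \<in> (\<lambda>C. ?W `` C) ` (?N // ?S)" using quotientI[OF x(1)] by blast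
  qed
  moreover have "finite (?N // ?S)" by (rule finite_quotient) (auto simp: strong_equiv_def)
  ultimately show ?thesis
    unfolding num_weak_nodal_domains_def num_strong_nodal_domains_def
    by (meson card_image_le card_mono finite_imageI order_trans)
qed

section \<open>The Rayleigh quotient of rescaled nodal domains\<close>

lemma powr_convex_combination:
  fixes a b :: real
  assumes p: "p \<ge> 1" and ab: "0 \<le> a" "0 \<le> b" and \<theta>: "0 \<le> \<theta>" "\<theta> \<le> 1"
  shows "(\<theta> * a + (1 - \<theta>) * b) powr p \<le> \<theta> * a powr p + (1 - \<theta>) * b powr p"
proof -
  have shrink: "(t * c) powr p \<le> t * c powr p" if "0 \<le> t" "t \<le> 1" "0 \<le> c" for t c :: real
  proof -
    have "t powr p \<le> t powr 1" using that p by (intro powr_mono') auto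
    then have "t powr p * c powr p \<le> t * c powr p" using that by (intro mult_right_mono) auto
    then show ?thesis using that by (simp add: powr_mult)
  qed
  consider "a = 0" | "b = 0" | "a > 0" "b > 0" using ab by linarith
  then show ?thesis
  proof cases
    case 1 then show ?thesis using shrink[of "1 - \<theta>" b] p ab \<theta> by simp
  next
    case 2 then show ?thesis using shrink[of \<theta> a] p ab \<theta> by simp
  next
    case 3
    then show ?thesis
      using convex_onD[OF powr_convex[OF p], of "1 - \<theta>" a b] \<theta> by simp
  qed
qed

text \<open>
  For the values \<open>s\<close>, \<open>t\<close> of \<open>f\<close> at the ends of an edge (\<open>t\<close> multiplied by the signature) and the
  factors \<open>a\<close>, \<open>b\<close> by which \<open>f\<close> is rescaled there, the left-hand side is the contribution of the edge
  to the energy of the rescaled function. The right-hand side is what the eigenvalue equation gives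
  when it is tested with \<open>\<bar>a\<bar>\<^sup>p f\<close>. If \<open>a = b\<close> the two sides are equal. Otherwise \<open>s\<close> and \<open>- t\<close> do not have
  opposite signs, hence \<open>a * s - b * t\<close> is \<open>s - t\<close> times a convex combination of \<open>a\<close> and \<open>b\<close>, and the
  claim is Jensen's inequality for the function \<open>\<bar>x\<bar>\<^sup>p\<close>.
\<close>

lemma edge_inequality:
  fixes s t a b z :: real
  assumes p: "p \<ge> 1" and z: "z * (s - t) = \<bar>s - t\<bar> powr p" and ab: "a = b \<or> s * t \<le> 0"
  shows "\<bar>a * s - b * t\<bar> powr p \<le> z * (\<bar>a\<bar> powr p * s - \<bar>b\<bar> powr p * t)"
proof (cases "a = b")
  case True
  have "\<bar>a * s - b * t\<bar> powr p = \<bar>a\<bar> powr p * \<bar>s - t\<bar> powr p"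
    unfolding True by (simp add: abs_mult powr_mult flip: right_diff_distrib)
  also have "\<dots> = z * (\<bar>a\<bar> powr p * s - \<bar>b\<bar> powr p * t)"
    unfolding z[symmetric] True by (simp add: algebra_simps)
  finally show ?thesis by simp
next
  case False
  then have st: "s * t \<le> 0" using ab by simp
  define D where "D = s - t"
  show ?thesis
  proof (cases "D = 0")
    case True
    then have "s = t" by (simp add: D_def)
    with st have "s = 0" "t = 0" by (auto simp: mult_le_0_iff)
    then show ?thesis by simp
  next
    case D: False
    define \<theta> where "\<theta> = s / D"
    have "D * D > 0" using D by (simp add: zero_less_mult_iff not_less) linarith
    have sD: "s = \<theta> * D" and tD: "t = - (1 - \<theta>) * D" using D by (simp_all add: \<theta>_def D_def field_simps)
    have "0 \<le> s * D" "t * D \<le> 0"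
      using st zero_le_square[of s] zero_le_square[of t]
      unfolding D_def right_diff_distrib mult.commute[of t s] by linarith+
    moreover have "s * D = \<theta> * (D * D)" "t * D = - ((1 - \<theta>) * (D * D))"
      by (subst sD, simp) (subst tD, simp add: algebra_simps)
    ultimately have "0 \<le> \<theta> * (D * D)" "0 \<le> (1 - \<theta>) * (D * D)" by linarith+
    then have \<theta>: "0 \<le> \<theta>" "\<theta> \<le> 1" using \<open>D * D > 0\<close> by (simp_all add: zero_le_mult_iff)
    have "\<bar>\<theta> * a + (1 - \<theta>) * b\<bar> \<le> \<theta> * \<bar>a\<bar> + (1 - \<theta>) * \<bar>b\<bar>"
      using abs_triangle_ineq[of "\<theta> * a" "(1 - \<theta>) * b"] \<theta> by (simp add: abs_mult)
    then have "\<bar>\<theta> * a + (1 - \<theta>) * b\<bar> powr p \<le> (\<theta> * \<bar>a\<bar> + (1 - \<theta>) * \<bar>b\<bar>) powr p"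
      using p by (intro powr_mono2) auto
    also have "\<dots> \<le> \<theta> * \<bar>a\<bar> powr p + (1 - \<theta>) * \<bar>b\<bar> powr p"
      by (rule powr_convex_combination) (use p \<theta> in auto)
    finally have jensen: "\<bar>\<theta> * a + (1 - \<theta>) * b\<bar> powr p \<le> \<theta> * \<bar>a\<bar> powr p + (1 - \<theta>) * \<bar>b\<bar> powr p" .
    have zD: "\<bar>D\<bar> powr p = z * D" using z by (simp add: D_def)
    have "a * s - b * t = (\<theta> * a + (1 - \<theta>) * b) * D" unfolding sD tD by (simp add: algebra_simps)
    then have "\<bar>a * s - b * t\<bar> powr p = \<bar>\<theta> * a + (1 - \<theta>) * b\<bar> powr p * \<bar>D\<bar> powr p"
      by (simp add: abs_mult powr_mult)
    also have "\<dots> \<le> (\<theta> * \<bar>a\<bar> powr p + (1 - \<theta>) * \<bar>b\<bar> powr p) * \<bar>D\<bar> powr p"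
      by (rule mult_right_mono[OF jensen]) simp
    also have "\<dots> = z * (\<bar>a\<bar> powr p * s - \<bar>b\<bar> powr p * t)"
      unfolding zD sD tD by (simp add: algebra_simps)
    finally show ?thesis .
  qed
qed

lemma Phi_mult: "Phi p t * t = \<bar>t\<bar> powr p"
proof (cases "t = 0")
  case False
  have "t * t = \<bar>t\<bar> powr 2" using False by (simp add: power2_eq_square)
  then have "\<bar>t\<bar> powr (p - 2) * (t * t) = \<bar>t\<bar> powr (p - 2) * \<bar>t\<bar> powr 2" by simp
  also have "\<dots> = \<bar>t\<bar> powr p" unfolding powr_add[symmetric] by simp
  finally show ?thesis using False by (simp add: Phi_def mult.assoc)
qed (simp add: Phi_def)

lemma Phi_minus: "Phi p (- t) = - Phi p t"
  by (simp add: Phi_def)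

lemma Sgn_mult: "z \<in> Sgn t \<Longrightarrow> z * t = \<bar>t\<bar>"
  by (auto simp: Sgn_def split: if_splits)

text \<open>
  A common form of the eigenvalue equations for \<open>p > 1\<close> and \<open>p = 1\<close>: all that matters about the
  fluxes \<open>z\<close> is their antisymmetry and their product with the differences of \<open>f\<close>.
\<close>

lemma eigenpair_fluxes:
  assumes graph: "weighted_signed_graph E w \<mu> \<sigma>" and p: "p \<ge> 1"
    and eig: "is_eigenpair E w \<mu> \<kappa> \<sigma> p f lam"
  obtains z u u' where
    "\<And>x y. {x, y} \<in> E \<Longrightarrow> z y x = - \<sigma> {x, y} * z x y"
    "\<And>x y. {x, y} \<in> E \<Longrightarrow>
       z x y * (f $ x - \<sigma> {x, y} * f $ y) = \<bar>f $ x - \<sigma> {x, y} * f $ y\<bar> powr p"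
    "\<And>x. u x * f $ x = \<bar>f $ x\<bar> powr p" "\<And>x. u' x * f $ x = \<bar>f $ x\<bar> powr p"
    "\<And>x. (\<Sum>y | {x, y} \<in> E. w {x, y} * z x y) + \<kappa> x * u x = lam * \<mu> x * u' x"
proof (cases "p = 1")
  case True
  then obtain z u u' where z: "\<And>x y. {x, y} \<in> E \<Longrightarrow>
      z x y \<in> Sgn (f $ x - \<sigma> {x, y} * f $ y) \<and> z x y = - \<sigma> {x, y} * z y x"
    and u: "\<And>x. u x \<in> Sgn (f $ x) \<and> u' x \<in> Sgn (f $ x)"
    and eq: "\<And>x. (\<Sum>y | {x, y} \<in> E. w {x, y} * z x y) + \<kappa> x * u x = lam * \<mu> x * u' x"
    using eig unfolding is_eigenpair_def True by (simp only: simp_thms if_True) blast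
  show ?thesis
  proof (rule that[of z u u'])
    show "z y x = - \<sigma> {x, y} * z x y" if "{x, y} \<in> E" for x y
      using z[of y x] that by (simp add: insert_commute)
    show "z x y * (f $ x - \<sigma> {x, y} * f $ y) = \<bar>f $ x - \<sigma> {x, y} * f $ y\<bar> powr p"
      if "{x, y} \<in> E" for x y
      using Sgn_mult[OF conjunct1[OF z[OF that]]] True by simp
    show "u x * f $ x = \<bar>f $ x\<bar> powr p" "u' x * f $ x = \<bar>f $ x\<bar> powr p" for x
      using Sgn_mult[OF conjunct1[OF u[of x]]] Sgn_mult[OF conjunct2[OF u[of x]]] True by simp_all
  qed (rule eq)
next
  case False
  show ?thesis
  proof (rule that[of "\<lambda>x y. Phi p (f $ x - \<sigma> {x, y} * f $ y)" "\<lambda>x. Phi p (f $ x)" "\<lambda>x. Phi p (f $ x)"])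
    show "Phi p (f $ y - \<sigma> {y, x} * f $ x) = - \<sigma> {x, y} * Phi p (f $ x - \<sigma> {x, y} * f $ y)"
      if "{x, y} \<in> E" for x y
    proof -
      have "\<sigma> {x, y} = 1 \<or> \<sigma> {x, y} = - 1" using graph that unfolding weighted_signed_graph_def by blast
      then show ?thesis
        using Phi_minus[of p "f $ x - f $ y"] by (auto simp: insert_commute[of y x] add.commute)
    qed
  qed (use eig False in \<open>auto simp: Phi_mult is_eigenpair_def p_Laplacian_def\<close>)
qed

lemma sum_adjacent_swap:
  fixes F :: "'v::finite \<Rightarrow> 'v \<Rightarrow> real"
  shows "(\<Sum>x\<in>UNIV. \<Sum>y | {x, y} \<in> E. F x y) = (\<Sum>x\<in>UNIV. \<Sum>y | {x, y} \<in> E. F y x)"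
proof -
  have "(\<Sum>x\<in>UNIV. \<Sum>y | {x, y} \<in> E. F x y) = (\<Sum>x\<in>UNIV. \<Sum>y\<in>UNIV. if {x, y} \<in> E then F x y else 0)"
    by (simp add: sum.If_cases)
  also have "\<dots> = (\<Sum>y\<in>UNIV. \<Sum>x\<in>UNIV. if {x, y} \<in> E then F x y else 0)" by (rule sum.swap)
  also have "\<dots> = (\<Sum>x\<in>UNIV. \<Sum>y | {x, y} \<in> E. F y x)"
    by (simp add: sum.If_cases insert_commute)
  finally show ?thesis .
qed

text \<open>
  Test the eigenvalue equation with \<open>\<bar>\<alpha>\<bar>\<^sup>p f\<close> and sum by parts; the antisymmetry of the fluxes turns the
  result into a sum over edges, which \<open>edge_inequality\<close> compares with the energy of \<open>\<alpha> f\<close>. The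
  inequality applies to every edge because \<open>\<alpha>\<close> takes the same value at both ends of an edge on which
  \<open>f(x) \<sigma>\<^sub>x\<^sub>y f(y)\<close> is positive.
\<close>

lemma Rayleigh_le_eigenvalue:
  assumes graph: "weighted_signed_graph E w \<mu> \<sigma>" and p: "p \<ge> 1"
    and eig: "is_eigenpair E w \<mu> \<kappa> \<sigma> p f lam"
    and v: "\<And>x. v $ x = \<alpha> x * f $ x"
    and \<alpha>: "\<And>x y. (x, y) \<in> positive_edges E \<sigma> f \<Longrightarrow> \<alpha> x = \<alpha> y"
    and "v \<in> p_sphere \<mu> p"
  shows "Rayleigh E w \<mu> \<kappa> \<sigma> p v \<le> lam"
proof -
  obtain z u u' where z: "\<And>x y. {x, y} \<in> E \<Longrightarrow> z y x = - \<sigma> {x, y} * z x y"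
    and zD: "\<And>x y. {x, y} \<in> E \<Longrightarrow>
       z x y * (f $ x - \<sigma> {x, y} * f $ y) = \<bar>f $ x - \<sigma> {x, y} * f $ y\<bar> powr p"
    and u: "\<And>x. u x * f $ x = \<bar>f $ x\<bar> powr p" and u': "\<And>x. u' x * f $ x = \<bar>f $ x\<bar> powr p"
    and eq: "\<And>x. (\<Sum>y | {x, y} \<in> E. w {x, y} * z x y) + \<kappa> x * u x = lam * \<mu> x * u' x"
    using eigenpair_fluxes[OF graph p eig] by blast
  define h where "h x = \<bar>\<alpha> x\<bar> powr p * f $ x" for x
  have uh: "u x * h x = \<bar>v $ x\<bar> powr p" "u' x * h x = \<bar>v $ x\<bar> powr p" for x
    using u[of x] u'[of x] by (simp_all add: h_def v abs_mult powr_mult mult.left_commute)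
  define S where "S = (\<Sum>x\<in>UNIV. \<Sum>y | {x, y} \<in> E. w {x, y} * (z x y * h x))"
  have norm: "(\<Sum>x\<in>UNIV. \<mu> x * \<bar>v $ x\<bar> powr p) = 1" using assms(6) by (simp add: p_sphere_def)
  have "(\<Sum>y | {x, y} \<in> E. w {x, y} * (z x y * h x)) + \<kappa> x * \<bar>v $ x\<bar> powr p
      = lam * (\<mu> x * \<bar>v $ x\<bar> powr p)" for x
  proof -
    have "(\<Sum>y | {x, y} \<in> E. w {x, y} * (z x y * h x)) + \<kappa> x * \<bar>v $ x\<bar> powr p
      = ((\<Sum>y | {x, y} \<in> E. w {x, y} * z x y) + \<kappa> x * u x) * h x"
      by (simp add: distrib_right sum_distrib_right mult.assoc uh)
    then show ?thesis unfolding eq by (simp add: mult.assoc uh)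
  qed
  then have "S + (\<Sum>x\<in>UNIV. \<kappa> x * \<bar>v $ x\<bar> powr p) = lam * (\<Sum>x\<in>UNIV. \<mu> x * \<bar>v $ x\<bar> powr p)"
    unfolding S_def by (simp add: sum_distrib_left flip: sum.distrib)
  then have total: "S + (\<Sum>x\<in>UNIV. \<kappa> x * \<bar>v $ x\<bar> powr p) = lam" by (simp add: norm)
  have "S + S = (\<Sum>x\<in>UNIV. \<Sum>y | {x, y} \<in> E. w {x, y} * (z x y * h x))
      + (\<Sum>x\<in>UNIV. \<Sum>y | {x, y} \<in> E. w {y, x} * (z y x * h y))"
    using sum_adjacent_swap[where E = E and F = "\<lambda>x y. w {x, y} * (z x y * h x)"] unfolding S_def by linarith
  also have "\<dots> = (\<Sum>x\<in>UNIV. \<Sum>y | {x, y} \<in> E. w {x, y} * (z x y * (h x - \<sigma> {x, y} * h y)))"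
    unfolding sum.distrib[symmetric]
  proof (intro sum.cong refl)
    fix x y assume "y \<in> {y. {x, y} \<in> E}"
    then have zyx: "z y x = - \<sigma> {x, y} * z x y" using z by simp
    show "w {x, y} * (z x y * h x) + w {y, x} * (z y x * h y) = w {x, y} * (z x y * (h x - \<sigma> {x, y} * h y))"
      unfolding insert_commute[of y x] zyx by (simp add: algebra_simps)
  qed
  finally have SS: "S + S = \<dots>" .
  have "(\<Sum>x\<in>UNIV. \<Sum>y | {x, y} \<in> E. w {x, y} * \<bar>v $ x - \<sigma> {x, y} * v $ y\<bar> powr p) \<le> S + S"
    unfolding SS
  proof (intro sum_mono mult_left_mono)
    fix x y assume "y \<in> {y. {x, y} \<in> E}"
    then have xy: "{x, y} \<in> E" by simp
    then show "0 \<le> w {x, y}" using graph unfolding weighted_signed_graph_def by (meson less_imp_le)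
    have "\<alpha> x = \<alpha> y \<or> f $ x * (\<sigma> {x, y} * f $ y) \<le> 0"
      using \<alpha>[of x y] xy unfolding positive_edges_def by (force simp: mult.assoc not_le)
    from edge_inequality[OF p zD[OF xy] this]
    show "\<bar>v $ x - \<sigma> {x, y} * v $ y\<bar> powr p \<le> z x y * (h x - \<sigma> {x, y} * h y)"
      by (simp add: v h_def mult.left_commute)
  qed
  then show ?thesis
    using total unfolding Rayleigh_def norm by simp
qed

section \<open>The genus of a sphere in a linear span\<close>

lemma continuous_on_abs_powr:
  fixes g :: "'a::topological_space \<Rightarrow> real"
  assumes "p \<ge> 1" "continuous_on S g"
  shows "continuous_on S (\<lambda>v. \<bar>g v\<bar> powr p)"
  by (intro continuous_on_powr' continuous_on_rabs assms continuous_on_const) (use assms in auto)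

lemma compact_p_sphere:
  fixes \<mu> :: "'v::finite \<Rightarrow> real"
  assumes \<mu>: "\<And>x. \<mu> x > 0" and p: "p \<ge> 1"
  shows "compact (p_sphere \<mu> p)"
proof -
  have "closed (p_sphere \<mu> p)"
  proof -
    have "continuous_on UNIV (\<lambda>f::real ^ 'v. \<Sum>x\<in>UNIV. \<mu> x * \<bar>f $ x\<bar> powr p)"
      by (intro continuous_intros continuous_on_abs_powr p)
    then have "closed ((\<lambda>f::real ^ 'v. \<Sum>x\<in>UNIV. \<mu> x * \<bar>f $ x\<bar> powr p) -` {1})"
      by (intro closed_vimage) auto
    then show ?thesis by (simp add: p_sphere_def vimage_def)
  qed
  moreover have "bounded (p_sphere \<mu> p)"
  proof -
    define M where "M x = (1 / \<mu> x) powr (1 / p)" for x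
    have "\<bar>f $ x\<bar> \<le> M x" if "f \<in> p_sphere \<mu> p" for f x
    proof -
      have "\<mu> x * \<bar>f $ x\<bar> powr p \<le> (\<Sum>x\<in>UNIV. \<mu> x * \<bar>f $ x\<bar> powr p)"
        by (rule member_le_sum) (simp_all add: less_imp_le[OF \<mu>])
      then have "\<bar>f $ x\<bar> powr p \<le> 1 / \<mu> x"
        using that \<mu>[of x] by (simp add: p_sphere_def field_simps)
      then have "(\<bar>f $ x\<bar> powr p) powr (1 / p) \<le> M x"
        unfolding M_def using p by (intro powr_mono2) auto
      then show ?thesis using p by (simp add: powr_powr)
    qed
    then have "norm f \<le> (\<Sum>x\<in>UNIV. M x)" if "f \<in> p_sphere \<mu> p" for f
      using norm_le_l1_cart[of f] that by (meson order_trans sum_mono)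
    then show ?thesis unfolding bounded_iff by blast
  qed
  ultimately show ?thesis by (simp add: compact_eq_bounded_closed)
qed

definition p_norm :: "('v::finite \<Rightarrow> real) \<Rightarrow> real \<Rightarrow> real ^ 'v \<Rightarrow> real" where
  "p_norm \<mu> p v = (\<Sum>x\<in>UNIV. \<mu> x * \<bar>v $ x\<bar> powr p) powr (1 / p)"

lemma p_norm_pos:
  fixes v :: "real ^ 'v::finite"
  assumes \<mu>: "\<And>x. \<mu> x > 0" and "v \<noteq> 0"
  shows "0 < (\<Sum>x\<in>UNIV. \<mu> x * \<bar>v $ x\<bar> powr p)"
proof -
  obtain x where "v $ x \<noteq> 0" using \<open>v \<noteq> 0\<close> by (auto simp: vec_eq_iff)
  then have "0 < \<mu> x * \<bar>v $ x\<bar> powr p"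
    by (intro mult_pos_pos \<mu>) (simp add: powr_gt_zero)
  then show ?thesis
    by (rule sum_pos2[rotated 2]) (simp_all add: less_imp_le[OF \<mu>])
qed

lemma normalized_in_p_sphere:
  assumes \<mu>: "\<And>x. \<mu> x > 0" and p: "p \<ge> 1" and v: "v \<noteq> 0"
  shows "(1 / p_norm \<mu> p v) *\<^sub>R v \<in> p_sphere \<mu> p"
proof -
  let ?s = "\<Sum>x\<in>UNIV. \<mu> x * \<bar>v $ x\<bar> powr p"
  have s: "?s > 0" by (rule p_norm_pos[OF \<mu> v])
  then have pos: "p_norm \<mu> p v > 0" by (simp add: p_norm_def)
  have "p_norm \<mu> p v powr p = ?s" using s p by (simp add: p_norm_def powr_powr)
  then have "\<mu> x * \<bar>((1 / p_norm \<mu> p v) *\<^sub>R v) $ x\<bar> powr p = \<mu> x * \<bar>v $ x\<bar> powr p / ?s" for x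
    using pos by (simp add: abs_mult powr_divide)
  then show ?thesis using s unfolding p_sphere_def by (simp flip: sum_divide_distrib)
qed

lemma p_norm_minus [simp]: "p_norm \<mu> p (- v) = p_norm \<mu> p v"
  by (simp add: p_norm_def)

lemma continuous_on_p_norm:
  assumes \<mu>: "\<And>x. \<mu> x > 0" and p: "p \<ge> 1" and "0 \<notin> S"
  shows "continuous_on S (p_norm \<mu> p)"
  unfolding p_norm_def
proof (rule continuous_on_powr')
  show "continuous_on S (\<lambda>v. \<Sum>x\<in>UNIV. \<mu> x * \<bar>v $ x\<bar> powr p)"
    by (intro continuous_intros continuous_on_abs_powr p)
  show "\<forall>v\<in>S. 0 \<le> (\<Sum>x\<in>UNIV. \<mu> x * \<bar>v $ x\<bar> powr p) \<and>
      ((\<Sum>x\<in>UNIV. \<mu> x * \<bar>v $ x\<bar> powr p) = 0 \<longrightarrow> 1 / p > 0)"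
  proof
    fix v assume "v \<in> S"
    then have "v \<noteq> 0" using \<open>0 \<notin> S\<close> by blast
    from p_norm_pos[where p = p and \<mu> = \<mu>, OF \<mu> this]
    show "0 \<le> (\<Sum>x\<in>UNIV. \<mu> x * \<bar>v $ x\<bar> powr p) \<and>
      ((\<Sum>x\<in>UNIV. \<mu> x * \<bar>v $ x\<bar> powr p) = 0 \<longrightarrow> 1 / p > 0)" by simp
  qed
qed (rule continuous_on_const)

text \<open>
  The cross-polytope on the \<open>b i\<close> maps to this set by the odd continuous map \<open>v / \<parallel>v\<parallel>\<close>. Composing it with
  an odd map into \<open>\<real>\<^sup>l - {0}\<close>, where \<open>l \<le> k\<close>, would contradict the Borsuk--Ulam theorem.
\<close>

lemma genus_p_sphere_span:
  fixes b :: "nat \<Rightarrow> real ^ 'v::finite"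
  assumes \<mu>: "\<And>x. \<mu> x > 0" and p: "p \<ge> 1"
    and indep: "\<And>a. (\<Sum>i\<le>k. a i *\<^sub>R b i) = 0 \<Longrightarrow> \<forall>i\<le>k. a i = 0"
  shows "p_sphere \<mu> p \<inter> span (b ` {..k}) \<in> genus_family \<mu> p (k + 1)"
proof -
  let ?A = "p_sphere \<mu> p \<inter> span (b ` {..k})" and ?K = "cross_polytope b k"
  define r where "r v = (1 / p_norm \<mu> p v) *\<^sub>R v" for v
  have K0: "0 \<notin> ?K" using zero_notin_cross_polytope[of b k, OF indep] .
  have rA: "r v \<in> ?A" if "v \<in> ?K" for v
  proof -
    have "v \<noteq> 0" using that K0 by blast
    then have "r v \<in> p_sphere \<mu> p"
      unfolding r_def by (rule normalized_in_p_sphere[OF \<mu> p])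
    moreover have "r v \<in> span (b ` {..k})"
      unfolding r_def using cross_polytope_subset_span[of b k] that by (intro span_scale) blast
    ultimately show ?thesis by (rule IntI)
  qed
  have r_cont: "continuous_on ?K r"
  proof -
    have "p_norm \<mu> p v \<noteq> 0" if "v \<in> ?K" for v
      using p_norm_pos[where v = v and p = p and \<mu> = \<mu>, OF \<mu>] K0 that unfolding p_norm_def by (metis less_irrefl powr_eq_0_iff)
    then show ?thesis
      unfolding r_def by (intro continuous_intros continuous_on_p_norm[OF \<mu> p K0]) auto
  qed
  have r_odd: "r (- v) = - r v" for v by (simp add: r_def)
  have "enat (k + 1) \<le> genus ?A"
  proof -
    have "b 0 \<in> ?K"
      using facet_vertex_setsI[of k "\<lambda>_. 1" b] unfolding cross_polytope_def
      by (intro UN_I[where a="(\<lambda>i. 1 *\<^sub>R b i) ` {..k}"] hull_inc) auto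
    then have "?A \<noteq> {}" using rA by blast
    moreover have "enat (k + 1) \<le> enat l"
      if "continuous_map (top_of_set ?A) (Euclidean_space l) g" "\<forall>x\<in>?A. g (- x) = - g x"
        "\<forall>x\<in>?A. g x \<noteq> (\<lambda>i. 0)" for l g
    proof (rule ccontr)
      assume "\<not> enat (k + 1) \<le> enat l"
      then have "l \<le> k" by simp
      have "continuous_map (top_of_set ?A) euclideanreal (\<lambda>x. g x i)" for i
        using that(1) unfolding Euclidean_space_def continuous_map_in_subtopology
          continuous_map_componentwise_UNIV by blast
      then have cont: "continuous_on ?A (\<lambda>x. g x i)" for i
        by (simp only: continuous_map_iff_continuous)
      obtain v where v: "v \<in> ?K" "\<And>i. i < k \<Longrightarrow> g (r v) i = 0"
      proof (rule borsuk_ulam[where n = k and b = b and g = "\<lambda>v i. g (r v) i"])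
        show "continuous_on ?K (\<lambda>v. g (r v) i)" for i
          by (rule continuous_on_compose2[OF cont r_cont]) (use rA in blast)
        show "g (r (- v)) i = - g (r v) i" if "v \<in> ?K" for v i
          using \<open>\<forall>x\<in>?A. g (- x) = - g x\<close> rA[OF that] by (simp add: r_odd)
      qed (use indep in auto)
      have "g (r v) \<in> topspace (Euclidean_space l)"
        using that(1) rA[OF v(1)] unfolding continuous_map_def by auto
      then have "g (r v) i = 0" for i
        using v(2)[of i] \<open>l \<le> k\<close> unfolding topspace_Euclidean_space by (cases "i < k") auto
      then show False using that(3) rA[OF v(1)] by blast
    qed
    ultimately show ?thesis unfolding genus_def by (auto intro!: Inf_greatest)
  qed
  moreover have "uminus ` ?A = ?A"
  proof -
    have "- v \<in> ?A" if "v \<in> ?A" for v using that by (auto simp: p_sphere_def span_neg)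
    then show ?thesis by (force simp: image_iff)
  qed
  moreover have "compact ?A"
    by (intro compact_Int_closed compact_p_sphere \<mu> p closed_span)
  ultimately show ?thesis unfolding genus_family_def by simp
qed

section \<open>Courant's nodal domain theorem\<close>

text \<open>
  The infimum and the supremum over reals behave as expected here because the Rayleigh quotient is
  continuous on the compact sphere, hence bounded.
\<close>

lemma variational_eigenvalue_le:
  assumes \<mu>: "\<And>x. \<mu> x > 0" and p: "p \<ge> 1" and k: "k \<ge> 1" and A: "A \<in> genus_family \<mu> p k"
    and le: "\<And>v. v \<in> A \<Longrightarrow> Rayleigh E w \<mu> \<kappa> \<sigma> p v \<le> lam"
  shows "variational_eigenvalue E w \<mu> \<kappa> \<sigma> p k \<le> lam"
proof -
  let ?R = "Rayleigh E w \<mu> \<kappa> \<sigma> p"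
  define N where "N v = (\<Sum>x\<in>UNIV. \<Sum>y | {x, y} \<in> E. w {x, y} * \<bar>v $ x - \<sigma> {x, y} * v $ y\<bar> powr p) / 2
        + (\<Sum>x\<in>UNIV. \<kappa> x * \<bar>v $ x\<bar> powr p)" for v
  have "continuous_on (p_sphere \<mu> p) N"
    unfolding N_def by (intro continuous_intros continuous_on_abs_powr p) auto
  moreover have "?R v = N v" if "v \<in> p_sphere \<mu> p" for v
    using that by (simp add: Rayleigh_def N_def p_sphere_def)
  ultimately have "continuous_on (p_sphere \<mu> p) ?R"
    using continuous_on_cong[OF refl, of "p_sphere \<mu> p" ?R N] by blast
  then have "bounded (?R ` p_sphere \<mu> p)"
    by (intro compact_imp_bounded compact_continuous_image compact_p_sphere \<mu> p)
  then obtain C where C: "\<And>v. v \<in> p_sphere \<mu> p \<Longrightarrow> \<bar>?R v\<bar> \<le> C"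
    unfolding bounded_iff by auto
  have fam: "S \<subseteq> p_sphere \<mu> p" "S \<noteq> {}" if "S \<in> genus_family \<mu> p k" for S
    using that k unfolding genus_family_def genus_def by (auto simp: zero_enat_def)
  have "- C \<le> (SUP v\<in>S. ?R v)" if S: "S \<in> genus_family \<mu> p k" for S
  proof -
    obtain v where v: "v \<in> S" using fam[OF S] by blast
    have "bdd_above (?R ` S)" using C fam(1)[OF S] by (intro bdd_aboveI2[of _ _ C]) force
    then have "?R v \<le> (SUP v\<in>S. ?R v)" using v by (rule cSUP_upper2) simp
    then show ?thesis using C[of v] v fam(1)[OF S] by force
  qed
  then have "bdd_below ((\<lambda>S. SUP v\<in>S. ?R v) ` genus_family \<mu> p k)" by (intro bdd_belowI2)
  then have "variational_eigenvalue E w \<mu> \<kappa> \<sigma> p k \<le> (SUP v\<in>A. ?R v)"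
    unfolding variational_eigenvalue_def by (rule cINF_lower[OF _ A])
  also have "\<dots> \<le> lam" using fam(2)[OF A] le by (intro cSUP_least)
  finally show ?thesis .
qed

theorem theorem1:
  fixes E :: "'v::finite set set"
    and w :: "'v set \<Rightarrow> real"
    and \<mu> \<kappa> :: "'v \<Rightarrow> real"
    and \<sigma> :: "'v set \<Rightarrow> real"
    and p lam :: real
    and f :: "real ^ 'v"
    and k :: nat
  assumes "weighted_signed_graph E w \<mu> \<sigma>"
    and "p \<ge> 1"
    and "is_eigenpair E w \<mu> \<kappa> \<sigma> p f lam"
    and "k \<in> {1..CARD('v) - 1}"
    and "lam < variational_eigenvalue E w \<mu> \<kappa> \<sigma> p (k + 1)"
  shows "num_weak_nodal_domains E \<sigma> f \<le> num_strong_nodal_domains E \<sigma> f \<and>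
         num_strong_nodal_domains E \<sigma> f \<le> k"
proof (intro conjI num_weak_le_num_strong)
  let ?Q = "nonzero_set f // strong_equiv E \<sigma> f"
  have \<mu>: "\<mu> x > 0" for x using assms(1) by (simp add: weighted_signed_graph_def)
  show "num_strong_nodal_domains E \<sigma> f \<le> k"
  proof (rule ccontr)
    assume "\<not> ?thesis"
    then have "k + 1 \<le> card ?Q" by (simp add: num_strong_nodal_domains_def)
    then obtain Q where Q: "Q \<subseteq> ?Q" "card Q = k + 1" "finite Q"
      by (rule obtain_subset_with_card_n)
    then obtain dom where "bij_betw dom {0..<k + 1} Q" using ex_bij_betw_nat_finite[OF Q(3)] by auto
    then have dom: "inj_on dom {..k}" "\<And>i. i \<le> k \<Longrightarrow> dom i \<in> ?Q"
      using Q(1) by (auto simp: bij_betw_def atLeast0LessThan lessThan_Suc_atMost)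
    \<comment> \<open>Restrictions of \<open>f\<close> to \<open>k + 1\<close> different strong nodal domains.\<close>
    define b where "b i = (\<chi> x. if x \<in> dom i then f $ x else 0)" for i
    have disj: "i = j" if "i \<le> k" "j \<le> k" "x \<in> dom i" "x \<in> dom j" for i j x
      using quotient_disj[OF equiv_strong_equiv dom(2)[OF that(1)] dom(2)[OF that(2)]] that
        inj_onD[OF dom(1)] by blast
    have indep: "\<forall>i\<le>k. a i = 0" if sum0: "(\<Sum>i\<le>k. a i *\<^sub>R b i) = 0" for a
    proof (intro allI impI)
      fix i assume i: "i \<le> k"
      obtain x where x: "x \<in> dom i" "f $ x \<noteq> 0"
        using in_quotient_imp_non_empty[OF equiv_strong_equiv dom(2)[OF i]]
          in_quotient_imp_subset[OF equiv_strong_equiv dom(2)[OF i]] by (auto simp: nonzero_set_def)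
      have "0 = (\<Sum>j\<le>k. a j *\<^sub>R b j) $ x" by (simp add: sum0)
      also have "\<dots> = (\<Sum>j\<le>k. if j = i then a i * f $ x else 0)"
        unfolding sum_component
      proof (rule sum.cong[OF refl])
        fix j assume "j \<in> {..k}"
        then have "x \<in> dom j \<longleftrightarrow> j = i" using disj[OF i, of j x] x(1) by blast
        then show "(a j *\<^sub>R b j) $ x = (if j = i then a i * f $ x else 0)" by (simp add: b_def)
      qed
      also have "\<dots> = a i * f $ x" using i by simp
      finally show "a i = 0" using x(2) by simp
    qed
    \<comment> \<open>Functions \<open>\<alpha> f\<close> with \<open>\<alpha>\<close> constant on every strong nodal domain.\<close>
    let ?L = "{v. \<exists>\<alpha>. (\<forall>x. v $ x = \<alpha> x * f $ x) \<and> (\<forall>x y. (x, y) \<in> positive_edges E \<sigma> f \<longrightarrow> \<alpha> x = (\<alpha> y :: real))}"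
    have "span (b ` {..k}) \<subseteq> ?L"
    proof (rule span_minimal)
      show "b ` {..k} \<subseteq> ?L"
      proof (intro image_subsetI CollectI)
        fix i assume "i \<in> {..k}"
        then have i: "i \<le> k" by simp
        have "x \<in> dom i \<longleftrightarrow> y \<in> dom i" if "(x, y) \<in> positive_edges E \<sigma> f" for x y
        proof -
          have "(x, y) \<in> strong_equiv E \<sigma> f"
            using that positive_edges_nonzero[OF that] unfolding strong_equiv_eq by blast
          then show ?thesis
            using dom(2)[OF i] equiv_strong_equiv[of f E \<sigma>]
            by (metis in_quotient_imp_closed equivE symD)
        qed
        then show "\<exists>\<alpha>. (\<forall>x. b i $ x = \<alpha> x * f $ x) \<and>
            (\<forall>x y. (x, y) \<in> positive_edges E \<sigma> f \<longrightarrow> \<alpha> x = (\<alpha> y :: real))"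
          by (intro exI[of _ "\<lambda>x. if x \<in> dom i then 1 else 0"]) (auto simp: b_def)
      qed
      show "subspace ?L"
      proof (rule subspaceI)
        show "0 \<in> ?L" by (auto intro!: exI[of _ "\<lambda>_. 0"])
        show "u + v \<in> ?L" if "u \<in> ?L" "v \<in> ?L" for u v
        proof -
          obtain \<alpha> \<beta> :: "'v \<Rightarrow> real" where h:
            "\<forall>x. u $ x = \<alpha> x * f $ x" "\<forall>x y. (x, y) \<in> positive_edges E \<sigma> f \<longrightarrow> \<alpha> x = \<alpha> y"
            "\<forall>x. v $ x = \<beta> x * f $ x" "\<forall>x y. (x, y) \<in> positive_edges E \<sigma> f \<longrightarrow> \<beta> x = \<beta> y"
            using \<open>u \<in> ?L\<close> \<open>v \<in> ?L\<close> by blast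
          show ?thesis
          proof (intro CollectI exI[of _ "\<lambda>x. \<alpha> x + \<beta> x"] conjI allI impI)
            show "(u + v) $ x = (\<alpha> x + \<beta> x) * f $ x" for x using h by (simp add: distrib_right)
            show "\<alpha> x + \<beta> x = \<alpha> y + \<beta> y" if "(x, y) \<in> positive_edges E \<sigma> f" for x y
              using h that by metis
          qed
        qed
        show "c *\<^sub>R u \<in> ?L" if "u \<in> ?L" for c u
        proof -
          obtain \<alpha> :: "'v \<Rightarrow> real" where h:
            "\<forall>x. u $ x = \<alpha> x * f $ x" "\<forall>x y. (x, y) \<in> positive_edges E \<sigma> f \<longrightarrow> \<alpha> x = \<alpha> y"
            using \<open>u \<in> ?L\<close> by blast
          show ?thesis
          proof (intro CollectI exI[of _ "\<lambda>x. c * \<alpha> x"] conjI allI impI)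
            show "(c *\<^sub>R u) $ x = c * \<alpha> x * f $ x" for x using h by simp
            show "c * \<alpha> x = c * \<alpha> y" if "(x, y) \<in> positive_edges E \<sigma> f" for x y
              using h that by metis
          qed
        qed
      qed
    qed
    then have "Rayleigh E w \<mu> \<kappa> \<sigma> p v \<le> lam" if "v \<in> p_sphere \<mu> p \<inter> span (b ` {..k})" for v
      using Rayleigh_le_eigenvalue[OF assms(1-3)] that by blast
    then have "variational_eigenvalue E w \<mu> \<kappa> \<sigma> p (k + 1) \<le> lam"
      by (intro variational_eigenvalue_le[OF \<mu> assms(2) _ genus_p_sphere_span[OF \<mu> assms(2) indep]]) auto
    then show False using assms(5) by simp
  qed
qed

end
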